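(* Let $M,m,A,A_1,B,B_1>0$ and $\mu:=\frac{2M+m}{m}$, and assume $\mu>1+\frac{A}{4A_1}$, $\mu>1+\frac{B}{16B_1}$ and $(\mu-1)^{4/15}\left(\frac{4A_1}{A}\right)^{2/3}\neq\left(\frac{16B_1}{B}\right)^{2/5}$. Then in the isosceles Schwarzschild problem, both for angular momentum $C=0$ and for $C\ne0$, there exist triple collision solutions whose limiting geometric configuration at collision is a non-degenerate isosceles triangle that is not the geometric configuration of any homographic solution. In particular, there exist triple collision orbits which are neither homothetic nor homographic.
   Context: The isosceles Schwarzschild problem: two equal point masses $M$ move in a horizontal plane, symmetrically with respect to their midpoint $O$, and a third point mass $m$ moves on the vertical axis through $O$. Let $R>0$ be the distance between the equal masses and $z\in\mathbb R$ the signed height of $m$ above $O$. After reduction by rotations, with conserved angular momentum $C$, the motion is the Hamiltonian system on $\{(R,z,P_R,P_z):R>0\}$ with $$H_{\mathrm{red}}=\frac1M\left(P_R^2+\frac{C^2}{R^2}\right)+\frac{2M+m}{4Mm}P_z^2-\frac{A}{R}-\frac{B}{R^3}-\frac{4A_1}{(R^2+4z^2)^{1/2}}-\frac{16B_1}{(R^2+4z^2)^{3/2}}.$$ A solution is a triple collision solution if $(R,z)\to(0,0)$ as $t$ tends to the forward end of its maximal interval of existence; its limiting geometric configuration is the limit $\ell=\lim z/R\in[-\infty,\infty]$ there, and it is a non-degenerate triangle if $\ell$ is finite and nonzero. A solution is homographic if the geometric configuration of the masses remains similar to the initial one, i.e. in Jacobi coordinates (${\bf r}_1$ from one mass $M$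 to the other, ${\bf r}_2$ from their midpoint to $m$) ${\bf r}_1(t)=\varphi(t)\Omega(t){\bf a}_1$, ${\bf r}_2(t)=\varphi(t){\bf a}_2$ with $\varphi(t)\in\mathbb R\setminus\{0\}$ a scalar function, $\Omega(t)$ rotations about the vertical axis, ${\bf a}_1$ a fixed horizontal vector and ${\bf a}_2$ a fixed vertical vector, not both zero; it is homothetic if moreover the masses move on straight lines. The configuration $\ell$ is that of a homographic solution if some homographic solution has $z/R\equiv\ell$. *)

theory Defs
  imports "HOL-Analysis.Analysis"
begin

definition H_red :: "real \<Rightarrow> real \<Rightarrow> real \<Rightarrow> real \<Rightarrow> real \<Rightarrow> real \<Rightarrow> real \<Rightarrow>
    real \<Rightarrow> real \<Rightarrow> real \<Rightarrow> real \<Rightarrow> real" where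
  "H_red M m A A1 B B1 C R z PR Pz =
     1 / M * (PR^2 + C^2 / R^2) + (2*M + m) / (4*M*m) * Pz^2
     - A / R - B / R^3
     - 4*A1 / (R^2 + 4*z^2) powr (1/2)
     - 16*B1 / (R^2 + 4*z^2) powr (3/2)"

definition solution :: "real \<Rightarrow> real \<Rightarrow> real \<Rightarrow> real \<Rightarrow> real \<Rightarrow> real \<Rightarrow> real \<Rightarrow> ereal \<Rightarrow> ereal \<Rightarrow>
    (real \<Rightarrow> real) \<Rightarrow> (real \<Rightarrow> real) \<Rightarrow> (real \<Rightarrow> real) \<Rightarrow> (real \<Rightarrow> real) \<Rightarrow> bool" where
  "solution M m A A1 B B1 C a b R z PR Pz \<longleftrightarrow>
     a < b \<and>
     (\<forall>t\<in>einterval a b.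
        R t > 0 \<and>
        (R has_real_derivative
           deriv (\<lambda>p. H_red M m A A1 B B1 C (R t) (z t) p (Pz t)) (PR t)) (at t) \<and>
        (z has_real_derivative
           deriv (\<lambda>p. H_red M m A A1 B B1 C (R t) (z t) (PR t) p) (Pz t)) (at t) \<and>
        (PR has_real_derivative
           - deriv (\<lambda>x. H_red M m A A1 B B1 C x (z t) (PR t) (Pz t)) (R t)) (at t) \<and>
        (Pz has_real_derivative
           - deriv (\<lambda>y. H_red M m A A1 B B1 C (R t) y (PR t) (Pz t)) (z t)) (at t))"

definition maximal_solution :: "real \<Rightarrow> real \<Rightarrow> real \<Rightarrow> real \<Rightarrow> real \<Rightarrow> real \<Rightarrow> real \<Rightarrow> ereal \<Rightarrow> ereal \<Rightarrow>
    (real \<Rightarrow> real) \<Rightarrow> (real \<Rightarrow> real) \<Rightarrow> (real \<Rightarrow> real) \<Rightarrow> (real \<Rightarrow> real) \<Rightarrow> bool" where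
  "maximal_solution M m A A1 B B1 C a b R z PR Pz \<longleftrightarrow>
     solution M m A A1 B B1 C a b R z PR Pz \<and>
     (\<forall>a' b' R' z' PR' Pz'.
        a' \<le> a \<longrightarrow> b \<le> b' \<longrightarrow>
        solution M m A A1 B B1 C a' b' R' z' PR' Pz' \<longrightarrow>
        (\<forall>t\<in>einterval a b. R' t = R t \<and> z' t = z t \<and> PR' t = PR t \<and> Pz' t = Pz t) \<longrightarrow>
        a' = a \<and> b' = b)"

definition forward_end :: "ereal \<Rightarrow> real filter" where
  "forward_end b = filtercomap ereal (at_left b)"

lemma filtercomap_ereal_filtermap: "filtercomap ereal (filtermap ereal F) = F"
proof (rule antisym)
  show "filtercomap ereal (filtermap ereal F) \<le> F"
  proof (rule filter_leI)
    fix P assume "eventually P F"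
    then show "eventually P (filtercomap ereal (filtermap ereal F))"
      unfolding eventually_filtercomap eventually_filtermap
      by (intro exI[of _ "\<lambda>y. P (real_of_ereal y)"]) simp
  qed
qed (rule filtercomap_filtermap)

lemma forward_end_ereal: "forward_end (ereal b) = at_left b"
  by (simp add: forward_end_def at_left_ereal filtercomap_ereal_filtermap)

lemma forward_end_PInf: "forward_end \<infinity> = at_top"
  by (simp add: forward_end_def at_left_PInf filtercomap_ereal_filtermap)

definition triple_collision_solution :: "real \<Rightarrow> real \<Rightarrow> real \<Rightarrow> real \<Rightarrow> real \<Rightarrow> real \<Rightarrow> real \<Rightarrow>
    ereal \<Rightarrow> ereal \<Rightarrow> (real \<Rightarrow> real) \<Rightarrow> (real \<Rightarrow> real) \<Rightarrow> (real \<Rightarrow> real) \<Rightarrow> (real \<Rightarrow> real) \<Rightarrow> bool" where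
  "triple_collision_solution M m A A1 B B1 C a b R z PR Pz \<longleftrightarrow>
     maximal_solution M m A A1 B B1 C a b R z PR Pz \<and>
     (R \<longlongrightarrow> 0) (forward_end b) \<and> (z \<longlongrightarrow> 0) (forward_end b)"

definition limiting_configuration ::
    "ereal \<Rightarrow> (real \<Rightarrow> real) \<Rightarrow> (real \<Rightarrow> real) \<Rightarrow> ereal \<Rightarrow> bool" where
  "limiting_configuration b R z l \<longleftrightarrow> ((\<lambda>t. ereal (z t / R t)) \<longlongrightarrow> l) (forward_end b)"

definition nondegenerate_triangle :: "ereal \<Rightarrow> bool" where
  "nondegenerate_triangle l \<longleftrightarrow> \<bar>l\<bar> \<noteq> \<infinity> \<and> l \<noteq> 0"

(* Undoing the reduction by rotations: th is the polar angle of r1, with conjugate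
   momentum C = (M/2) R^2 th', i.e. th' is the derivative of H_red with respect to C. *)
definition jacobi_lift :: "real \<Rightarrow> real \<Rightarrow> real set \<Rightarrow> (real \<Rightarrow> real) \<Rightarrow> (real \<Rightarrow> real) \<Rightarrow>
    (real \<Rightarrow> real^3) \<Rightarrow> (real \<Rightarrow> real^3) \<Rightarrow> bool" where
  "jacobi_lift M C I R z r1 r2 \<longleftrightarrow>
     (\<exists>th. \<forall>t\<in>I.
        (th has_real_derivative 2 * C / (M * (R t)^2)) (at t) \<and>
        r1 t = R t *\<^sub>R vector [cos (th t), sin (th t), 0] \<and>
        r2 t = vector [0, 0, z t])"

definition vertical_rotation :: "real^3^3 \<Rightarrow> bool" where
  "vertical_rotation Q \<longleftrightarrow> rotation_matrix Q \<and> Q *v vector [0, 0, 1] = vector [0, 0, 1]"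

definition homographic_motion :: "real set \<Rightarrow> (real \<Rightarrow> real^3) \<Rightarrow> (real \<Rightarrow> real^3) \<Rightarrow> bool" where
  "homographic_motion I r1 r2 \<longleftrightarrow>
     (\<exists>(\<phi> :: real \<Rightarrow> real) (\<Omega> :: real \<Rightarrow> real^3^3) (a1 :: real^3) (a2 :: real^3).
        a1 $ 3 = 0 \<and> a2 $ 1 = 0 \<and> a2 $ 2 = 0 \<and> (a1 \<noteq> 0 \<or> a2 \<noteq> 0) \<and>
        (\<forall>t\<in>I. \<phi> t \<noteq> 0 \<and> vertical_rotation (\<Omega> t) \<and>
           r1 t = \<phi> t *\<^sub>R (\<Omega> t *v a1) \<and> r2 t = \<phi> t *\<^sub>R a2))"

(* The three mass positions relative to the centre of mass; the library's collinear
   says that a set is contained in a straight line. *)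
definition rectilinear_motion :: "real \<Rightarrow> real \<Rightarrow> real set \<Rightarrow>
    (real \<Rightarrow> real^3) \<Rightarrow> (real \<Rightarrow> real^3) \<Rightarrow> bool" where
  "rectilinear_motion M m I r1 r2 \<longleftrightarrow>
     collinear ((\<lambda>t. - (m / (2*M + m)) *\<^sub>R r2 t - (1/2) *\<^sub>R r1 t) ` I) \<and>
     collinear ((\<lambda>t. - (m / (2*M + m)) *\<^sub>R r2 t + (1/2) *\<^sub>R r1 t) ` I) \<and>
     collinear ((\<lambda>t. (2*M / (2*M + m)) *\<^sub>R r2 t) ` I)"

definition homographic_solution :: "real \<Rightarrow> real \<Rightarrow> real \<Rightarrow> real \<Rightarrow> real \<Rightarrow> real \<Rightarrow> real \<Rightarrow>
    ereal \<Rightarrow> ereal \<Rightarrow> (real \<Rightarrow> real) \<Rightarrow> (real \<Rightarrow> real) \<Rightarrow> (real \<Rightarrow> real) \<Rightarrow> (real \<Rightarrow> real) \<Rightarrow> bool" where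
  "homographic_solution M m A A1 B B1 C a b R z PR Pz \<longleftrightarrow>
     solution M m A A1 B B1 C a b R z PR Pz \<and>
     (\<exists>r1 r2. jacobi_lift M C (einterval a b) R z r1 r2 \<and>
        homographic_motion (einterval a b) r1 r2)"

definition homothetic_solution :: "real \<Rightarrow> real \<Rightarrow> real \<Rightarrow> real \<Rightarrow> real \<Rightarrow> real \<Rightarrow> real \<Rightarrow>
    ereal \<Rightarrow> ereal \<Rightarrow> (real \<Rightarrow> real) \<Rightarrow> (real \<Rightarrow> real) \<Rightarrow> (real \<Rightarrow> real) \<Rightarrow> (real \<Rightarrow> real) \<Rightarrow> bool" where
  "homothetic_solution M m A A1 B B1 C a b R z PR Pz \<longleftrightarrow>
     solution M m A A1 B B1 C a b R z PR Pz \<and>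
     (\<exists>r1 r2. jacobi_lift M C (einterval a b) R z r1 r2 \<and>
        homographic_motion (einterval a b) r1 r2 \<and>
        rectilinear_motion M m (einterval a b) r1 r2)"

(* The homographic solution may have any angular momentum and any interval. *)
definition homographic_configuration :: "real \<Rightarrow> real \<Rightarrow> real \<Rightarrow> real \<Rightarrow> real \<Rightarrow> real \<Rightarrow>
    ereal \<Rightarrow> bool" where
  "homographic_configuration M m A A1 B B1 l \<longleftrightarrow>
     (\<exists>C a b R z PR Pz.
        homographic_solution M m A A1 B B1 C a b R z PR Pz \<and>
        (\<forall>t\<in>einterval a b. ereal (z t / R t) = l))"

end

theory Submission
  imports Defs
begin

text \<open>
  Close to a triple collision the terms of degree \<open>-3\<close> of the potential dominate, and the problem
  looks like a Newtonian one with a potential homogeneous of degree \<open>-3\<close>. For that potential the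
  ray \<open>z = l R\<close> is invariant exactly when \<open>l = 0\<close> or \<open>(1 + 4 l\<^sup>2)\<^bsup>5/2\<^esup> = (\<mu> - 1) 16 B1 / B\<close>, and the
  second bound on \<open>\<mu>\<close> makes the right-hand side larger than 1, so that a triangle \<open>l > 0\<close> exists. The
  theorem follows from two facts about this \<open>l\<close>: some collision solution of the full problem is
  asymptotic to the ray, and no homographic solution lies on it.

  No homographic solution lies on the ray because the terms of degree \<open>-1\<close> of the potential are
  balanced along it only if \<open>(1 + 4 l\<^sup>2)\<^bsup>3/2\<^esup> = (\<mu> - 1) 4 A1 / A\<close>, which the inequation between the
  powers excludes. If \<open>z = l R\<close> holds identically, comparing the two accelerations then forces \<open>R\<close> to
  be a constant multiple of \<open>C\<^sup>2\<close>; but with \<open>R\<close> and \<open>z\<close> constant the mass \<open>m\<close> would be at rest off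
  the plane, where the force on it does not vanish (\<open>no_solution_on_ray\<close>). A homographic collision
  solution whose ratio \<open>z / R\<close> tends to \<open>l\<close> would lie on the ray close to collision
  (\<open>homographic_limit_ray\<close>), so it is excluded as well.

  For the collision solution, let \<open>\<tau>\<close> be the time left until collision. The leading problem has the
  homothetic solution \<open>\<tau>\<^bsup>2/5\<^esup> (\<rho>, l \<rho>)\<close>. Writing the full solution as
  \<open>\<tau>\<^bsup>2/5\<^esup> (\<rho>, l \<rho>) + \<tau>\<^bsup>1/2\<^esup> U(s)\<close> with \<open>s = - ln \<tau>\<close> turns the equations of motion into
  \<open>U'' = (1/100 + L) U + N(s, U)\<close>, where \<open>L\<close> is a constant matrix and \<open>N\<close> and its Lipschitz constant
  in \<open>U\<close> tend to 0 as \<open>s\<close> tends to infinity. The exponent \<open>1/2\<close> is the one for which no term \<open>U'\<close>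
  appears. The eigenvalues of \<open>L\<close> are \<open>6/5\<close>, in the direction of the ray, and a nonnegative number in
  the transverse direction, since the triangle is a minimum of the potential among shapes of fixed
  size. Hence the linear part has only real nonzero exponents, it is inverted on bounded functions by
  a Green function, and the contraction principle yields a bounded \<open>U\<close> (\<open>bounded_solution_exists\<close>,
  \<open>collision_along_hyperbolic_ray\<close>). The terms of degree \<open>-2\<close> (angular momentum) and \<open>-1\<close> of the
  Hamiltonian only enter \<open>N\<close>, which is why \<open>C = 0\<close> and \<open>C \<noteq> 0\<close> are treated alike. Boundedness of \<open>U\<close>
  gives \<open>R \<rightarrow> 0\<close>, \<open>z \<rightarrow> 0\<close> and \<open>z / R \<rightarrow> l\<close>. Zorn's lemma finally extends the solution to a maximal one,
  which still ends at the collision because \<open>R\<close> tends to 0 there (\<open>triple_collision_extension\<close>).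
\<close>

section \<open>Bounded solutions of weakly nonlinear hyperbolic equations\<close>

text \<open>
  The bounded solution of \<open>a' = k a - f\<close>; for positive \<open>k\<close> boundedness leaves no freedom in the
  initial value.
\<close>

definition tail_conv :: "real \<Rightarrow> (real \<Rightarrow> real) \<Rightarrow> real \<Rightarrow> real" where
  "tail_conv k f s = exp (k * s) * integral {s..} (\<lambda>\<sigma>. exp (-k * \<sigma>) * f \<sigma>)"

lemma tail_conv_integrable:
  fixes f :: "real \<Rightarrow> real"
  assumes "k > 0" "continuous_on UNIV f" "\<And>x. \<bar>f x\<bar> \<le> K"
  shows "(\<lambda>\<sigma>. exp (-k * \<sigma>) * f \<sigma>) integrable_on {s..}"
proof (rule measurable_bounded_by_integrable_imp_integrable)
  have "continuous_on {s..} f"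
    using assms(2) continuous_on_subset by blast
  then show "(\<lambda>\<sigma>. exp (-k * \<sigma>) * f \<sigma>) \<in> borel_measurable (lebesgue_on {s..})"
    by (intro continuous_imp_measurable_on_sets_lebesgue continuous_intros) auto
  show "(\<lambda>\<sigma>. K * exp (-k * \<sigma>)) integrable_on {s..}"
    using has_integral_exp_minus_to_infinity[OF assms(1), of s]
    by (intro integrable_on_mult_right) (auto simp: integrable_on_def)
  show "norm (exp (-k * \<sigma>) * f \<sigma>) \<le> K * exp (-k * \<sigma>)" for \<sigma>
    using assms(3)[of \<sigma>] by (simp add: abs_mult mult.commute mult_right_mono)
qed auto

lemma tail_conv_bound:
  fixes f :: "real \<Rightarrow> real"
  assumes "k > 0" "continuous_on UNIV f" "\<And>x. \<bar>f x\<bar> \<le> K"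
  shows "\<bar>tail_conv k f s\<bar> \<le> K / k"
proof -
  have I: "((\<lambda>\<sigma>. K * exp (-k * \<sigma>)) has_integral K * (exp (-k * s) / k)) {s..}"
    by (intro has_integral_mult_right has_integral_exp_minus_to_infinity assms)
  have "\<bar>integral {s..} (\<lambda>\<sigma>. exp (-k * \<sigma>) * f \<sigma>)\<bar> \<le> integral {s..} (\<lambda>\<sigma>. K * exp (-k * \<sigma>))"
    unfolding real_norm_def[symmetric]
  proof (rule integral_norm_bound_integral)
    show "(\<lambda>\<sigma>. exp (-k * \<sigma>) * f \<sigma>) integrable_on {s..}"
      by (rule tail_conv_integrable) fact+
    show "(\<lambda>\<sigma>. K * exp (-k * \<sigma>)) integrable_on {s..}"
      using I by blast
    show "norm (exp (-k * \<sigma>) * f \<sigma>) \<le> K * exp (-k * \<sigma>)" for \<sigma>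
      using assms(3)[of \<sigma>] by (simp add: abs_mult mult.commute mult_right_mono)
  qed
  also have "\<dots> = K * (exp (-k * s) / k)"
    using I by (rule integral_unique)
  finally have "\<bar>tail_conv k f s\<bar> \<le> exp (k * s) * (K * (exp (-k * s) / k))"
    unfolding tail_conv_def abs_mult by (intro mult_mono) auto
  also have "\<dots> = K / k"
    by (simp add: exp_minus field_simps)
  finally show ?thesis .
qed

lemma tail_conv_deriv:
  fixes f :: "real \<Rightarrow> real"
  assumes "k > 0" "continuous_on UNIV f" "\<And>x. \<bar>f x\<bar> \<le> K"
  shows "(tail_conv k f has_real_derivative k * tail_conv k f s - f s) (at s)"
proof -
  define h where "h = (\<lambda>\<sigma>. exp (-k * \<sigma>) * f \<sigma>)"
  have h: "h integrable_on {a..}" for a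
    unfolding h_def by (rule tail_conv_integrable) fact+
  have ch: "continuous_on X h" for X
    unfolding h_def using assms(2) continuous_on_subset by (intro continuous_intros) blast
  have split: "integral {a..} h = integral {a..x} h + integral {x..} h" if "a \<le> x" for a x
  proof -
    have "{a..x} \<inter> {x..} = {x}" "{a..} = {a..x} \<union> {x..}"
      using that by auto
    moreover have "h integrable_on {a..x}"
      by (intro integrable_continuous_interval ch)
    ultimately show ?thesis
      using h[of x] by (metis integral_Un negligible_sing)
  qed
  have "((\<lambda>x. integral {s-1..x} h) has_real_derivative h s) (at s within {s-1..s+1})"
    by (intro integral_has_real_derivative ch) auto
  then have "((\<lambda>x. integral {s-1..x} h) has_real_derivative h s) (at s)"
    by (subst (asm) at_within_interior) auto
  then have "((\<lambda>x. integral {s-1..} h - integral {s-1..x} h) has_real_derivative - h s) (at s)"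
    by (auto intro!: derivative_eq_intros)
  then have J: "((\<lambda>x. integral {x..} h) has_real_derivative - h s) (at s)"
  proof (rule DERIV_cong_ev[THEN iffD1, rotated -1])
    have "eventually (\<lambda>x. x \<in> {s-1<..}) (nhds s)"
      by (intro eventually_nhds_in_open) auto
    then show "eventually (\<lambda>x. integral {s-1..} h - integral {s-1..x} h = integral {x..} h) (nhds s)"
    proof eventually_elim
      fix x assume "x \<in> {s-1<..}"
      then show "integral {s-1..} h - integral {s-1..x} h = integral {x..} h"
        using split[of "s-1" x] by simp
    qed
  qed auto
  have "exp (k * s) * h s = f s"
    by (simp add: h_def exp_minus)
  then have "((\<lambda>x. exp (k * x) * integral {x..} h) has_real_derivative
      k * (exp (k * s) * integral {s..} h) - f s) (at s)"
    by (auto intro!: derivative_eq_intros J simp: mult.commute)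
  then show ?thesis
    unfolding tail_conv_def[abs_def] h_def by simp
qed

lemma tail_conv_diff:
  fixes f g :: "real \<Rightarrow> real"
  assumes "k > 0" "continuous_on UNIV f" "\<And>x. \<bar>f x\<bar> \<le> K"
    and "continuous_on UNIV g" "\<And>x. \<bar>g x\<bar> \<le> L"
  shows "tail_conv k f s - tail_conv k g s = tail_conv k (\<lambda>x. f x - g x) s"
  using integral_diff[OF tail_conv_integrable[OF assms(1-3)] tail_conv_integrable[OF assms(1,4,5)], of s]
  by (simp add: tail_conv_def right_diff_distrib)

text \<open>
  The Green function of \<open>u'' = k\<^sup>2 u + f\<close> for bounded functions on the line, that is
  \<open>- exp (- k \<bar>s - \<sigma>\<bar>) / (2 k)\<close>, integrated against \<open>f\<close>. The reflected term covers \<open>\<sigma> < s\<close>.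
\<close>

definition green :: "real \<Rightarrow> (real \<Rightarrow> real) \<Rightarrow> real \<Rightarrow> real" where
  "green k f s = - (tail_conv k f s + tail_conv k (\<lambda>x. f (- x)) (- s)) / (2 * k)"

lemma green_bound:
  fixes f :: "real \<Rightarrow> real"
  assumes "k > 0" "continuous_on UNIV f" "\<And>x. \<bar>f x\<bar> \<le> K"
  shows "\<bar>green k f s\<bar> \<le> K / k\<^sup>2"
proof -
  have c: "continuous_on UNIV (\<lambda>x. f (- x))"
    by (rule continuous_on_compose2[OF assms(2)]) (auto intro!: continuous_intros)
  have "\<bar>green k f s\<bar> = \<bar>tail_conv k f s + tail_conv k (\<lambda>x. f (- x)) (- s)\<bar> / (2 * k)"
    using assms(1) by (simp add: green_def abs_divide)
  also have "\<dots> \<le> (K / k + K / k) / (2 * k)"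
    using tail_conv_bound[OF assms, of s] tail_conv_bound[OF assms(1) c assms(3), of "- s"] assms(1)
    by (intro divide_right_mono order_trans[OF abs_triangle_ineq] add_mono) auto
  also have "\<dots> = K / k\<^sup>2"
    using assms(1) by (simp add: field_simps power2_eq_square)
  finally show ?thesis .
qed

lemma green_diff:
  fixes f g :: "real \<Rightarrow> real"
  assumes "k > 0" "continuous_on UNIV f" "\<And>x. \<bar>f x\<bar> \<le> K"
    and "continuous_on UNIV g" "\<And>x. \<bar>g x\<bar> \<le> L"
  shows "green k f s - green k g s = green k (\<lambda>x. f x - g x) s"
proof -
  have c: "continuous_on UNIV (\<lambda>x. f (- x))" "continuous_on UNIV (\<lambda>x. g (- x))"
    by (rule continuous_on_compose2[OF assms(2)] continuous_on_compose2[OF assms(4)];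
        auto intro!: continuous_intros)+
  show ?thesis
    unfolding green_def tail_conv_diff[OF assms, symmetric]
      tail_conv_diff[OF assms(1) c(1) assms(3) c(2) assms(5), symmetric]
    by (simp add: diff_divide_distrib add_divide_distrib)
qed

lemma green_deriv:
  fixes f :: "real \<Rightarrow> real"
  assumes "k > 0" "continuous_on UNIV f" "\<And>x. \<bar>f x\<bar> \<le> K"
  obtains u' where "\<And>s. (green k f has_real_derivative u' s) (at s)"
    "\<And>s. (u' has_real_derivative k\<^sup>2 * green k f s + f s) (at s)"
proof
  define u' where "u' s = - (tail_conv k f s - tail_conv k (\<lambda>x. f (- x)) (- s)) / 2" for s
  have c: "continuous_on UNIV (\<lambda>x. f (- x))"
    by (rule continuous_on_compose2[OF assms(2)]) (auto intro!: continuous_intros)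
  have 1: "(tail_conv k f has_real_derivative k * tail_conv k f s - f s) (at s)" for s
    by (rule tail_conv_deriv) fact+
  have 2: "((\<lambda>s. tail_conv k (\<lambda>x. f (- x)) (- s)) has_real_derivative
      - (k * tail_conv k (\<lambda>x. f (- x)) (- s) - f s)) (at s)" for s
    by (rule DERIV_cong[OF DERIV_chain2[OF tail_conv_deriv[OF assms(1) c assms(3)]]])
       (auto intro!: derivative_eq_intros)
  show "(green k f has_real_derivative u' s) (at s)" for s
    unfolding green_def[abs_def] using assms(1)
    by (auto intro!: derivative_eq_intros 1 2 simp: u'_def field_simps)
  show "(u' has_real_derivative k\<^sup>2 * green k f s + f s) (at s)" for s
    unfolding green_def u'_def[abs_def] using assms(1)
    by (auto intro!: derivative_eq_intros 1 2 simp: field_simps power2_eq_square)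
qed

text \<open>
  The bound on \<open>c\<close> makes the Green operators, applied to \<open>N1\<close> and \<open>N2\<close>, a contraction of the unit ball
  of bounded continuous curves with constant \<open>1/2\<close>. The nonlinearities are only controlled for
  \<open>s \<ge> S\<close>; freezing them at \<open>s = S\<close> for earlier times lets the argument run on the whole line, where
  the Green function is explicit.
\<close>

lemma bounded_solution_exists:
  fixes N1 N2 :: "real \<Rightarrow> real \<times> real \<Rightarrow> real"
  assumes k: "k1 > 0" "k2 > 0"
    and cont: "continuous_on ({S..} \<times> cball 0 1) (\<lambda>(s, x). N1 s x)"
      "continuous_on ({S..} \<times> cball 0 1) (\<lambda>(s, x). N2 s x)"
    and bnd: "\<And>s x. s \<ge> S \<Longrightarrow> norm x \<le> 1 \<Longrightarrow> \<bar>N1 s x\<bar> \<le> c"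
      "\<And>s x. s \<ge> S \<Longrightarrow> norm x \<le> 1 \<Longrightarrow> \<bar>N2 s x\<bar> \<le> c"
    and lip: "\<And>s x y. s \<ge> S \<Longrightarrow> norm x \<le> 1 \<Longrightarrow> norm y \<le> 1 \<Longrightarrow> \<bar>N1 s x - N1 s y\<bar> \<le> c * dist x y"
      "\<And>s x y. s \<ge> S \<Longrightarrow> norm x \<le> 1 \<Longrightarrow> norm y \<le> 1 \<Longrightarrow> \<bar>N2 s x - N2 s y\<bar> \<le> c * dist x y"
    and c: "c * (1 / k1\<^sup>2 + 1 / k2\<^sup>2) \<le> 1 / 2"
  obtains u v u' v' :: "real \<Rightarrow> real" where
    "\<And>s. norm (u s, v s) \<le> 1"
    "\<And>s. (u has_real_derivative u' s) (at s)" "\<And>s. (v has_real_derivative v' s) (at s)"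
    "\<And>s. s \<ge> S \<Longrightarrow> (u' has_real_derivative k1\<^sup>2 * u s + N1 s (u s, v s)) (at s)"
    "\<And>s. s \<ge> S \<Longrightarrow> (v' has_real_derivative k2\<^sup>2 * v s + N2 s (u s, v s)) (at s)"
proof -
  define X :: "(real \<Rightarrow>\<^sub>C (real \<times> real)) set" where "X = cball 0 1"
  \<comment> \<open>the nonlinearity along a curve, frozen before \<open>S\<close>\<close>
  define F where "F N = (\<lambda>(U :: real \<Rightarrow>\<^sub>C (real \<times> real)) s. N (max S s) (apply_bcontfun U s))"
    for N :: "real \<Rightarrow> real \<times> real \<Rightarrow> real"
  define T where "T U = (\<lambda>s. (green k1 (F N1 U) s, green k2 (F N2 U) s))" for U
  have XD: "norm (apply_bcontfun U s) \<le> 1" if "U \<in> X" for U s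
    using that norm_bounded[of U s] by (auto simp: X_def intro: order_trans)
  have Fc: "continuous_on UNIV (F N U)"
    if "continuous_on ({S..} \<times> cball 0 1) (\<lambda>(s, x). N s x)" "U \<in> X" for N U
  proof -
    have "continuous_on UNIV (\<lambda>s. (\<lambda>(s, x). N s x) (max S s, apply_bcontfun U s))"
      using XD[OF that(2)] by (intro continuous_on_compose2[OF that(1)] continuous_intros) auto
    then show ?thesis by (simp add: F_def)
  qed
  have Fb: "\<bar>F N1 U s\<bar> \<le> c" "\<bar>F N2 U s\<bar> \<le> c" if "U \<in> X" for U s
    using bnd XD[OF that] by (auto simp: F_def)
  have c0: "c \<ge> 0"
    using bnd(1)[of S 0] by simp
  have np: "norm (a, b) \<le> \<bar>a\<bar> + \<bar>b\<bar>" for a b :: real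
    using norm_Pair_le[of a b] by simp
  have two: "\<bar>a\<bar> + \<bar>b\<bar> \<le> d / 2" if "\<bar>a\<bar> \<le> c * d / k1\<^sup>2" "\<bar>b\<bar> \<le> c * d / k2\<^sup>2" "d \<ge> 0" for a b d :: real
  proof -
    have "\<bar>a\<bar> + \<bar>b\<bar> \<le> d * (c * (1 / k1\<^sup>2 + 1 / k2\<^sup>2))"
      using that by (simp add: field_simps)
    also have "\<dots> \<le> d * (1 / 2)"
      by (intro mult_left_mono c that)
    finally show ?thesis by simp
  qed
  have Tn: "norm (T U s) \<le> 1" if U: "U \<in> X" for U s
  proof -
    have "\<bar>green k1 (F N1 U) s\<bar> \<le> c * 1 / k1\<^sup>2" "\<bar>green k2 (F N2 U) s\<bar> \<le> c * 1 / k2\<^sup>2"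
      using green_bound[OF k(1) Fc[OF cont(1) U] Fb(1)[OF U], of s]
        green_bound[OF k(2) Fc[OF cont(2) U] Fb(2)[OF U], of s] by simp_all
    from two[OF this] show ?thesis
      using np[of "green k1 (F N1 U) s" "green k2 (F N2 U) s"] by (simp add: T_def)
  qed
  have Tc: "continuous_on UNIV (T U)" if U: "U \<in> X" for U
  proof -
    have "continuous_on UNIV (green k1 (F N1 U))"
      by (rule green_deriv[OF k(1) Fc[OF cont(1) U] Fb(1)[OF U]])
         (meson DERIV_continuous_on has_field_derivative_at_within)
    moreover have "continuous_on UNIV (green k2 (F N2 U))"
      by (rule green_deriv[OF k(2) Fc[OF cont(2) U] Fb(2)[OF U]])
         (meson DERIV_continuous_on has_field_derivative_at_within)
    ultimately show ?thesis
      unfolding T_def by (intro continuous_on_Pair)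
  qed
  define TT where "TT U = Bcontfun (T U)" for U
  have TT: "apply_bcontfun (TT U) = T U" if "U \<in> X" for U
    unfolding TT_def by (rule Bcontfun_inverse, rule bcontfun_normI[OF Tc[OF that] Tn[OF that]])
  have "\<exists>!U\<in>X. TT U = U"
  proof (rule Banach_fix[where c = "1/2"])
    show "complete X"
      unfolding X_def by (intro complete_eq_closed[THEN iffD2] closed_cball)
    show "X \<noteq> {}" by (simp add: X_def)
    show "TT ` X \<subseteq> X"
      using Tn TT by (auto simp: X_def intro!: norm_bound)
    show "\<And>U V. U \<in> X \<Longrightarrow> V \<in> X \<Longrightarrow> dist (TT U) (TT V) \<le> 1 / 2 * dist U V"
    proof (rule dist_bound)
      fix U V s assume UV: "U \<in> X" "V \<in> X"
      have L1: "\<bar>F N1 U x - F N1 V x\<bar> \<le> c * dist U V" for x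
        unfolding F_def
        using order_trans[OF lip(1)[OF max.cobounded1 XD[OF UV(1)] XD[OF UV(2)]]
            mult_left_mono[OF dist_bounded c0]] .
      have L2: "\<bar>F N2 U x - F N2 V x\<bar> \<le> c * dist U V" for x
        unfolding F_def
        using order_trans[OF lip(2)[OF max.cobounded1 XD[OF UV(1)] XD[OF UV(2)]]
            mult_left_mono[OF dist_bounded c0]] .
      have "\<bar>green k1 (F N1 U) s - green k1 (F N1 V) s\<bar> \<le> c * dist U V / k1\<^sup>2"
        using green_bound[OF k(1) continuous_on_diff[OF Fc[OF cont(1) UV(1)] Fc[OF cont(1) UV(2)]] L1]
          green_diff[OF k(1) Fc[OF cont(1) UV(1)] Fb(1)[OF UV(1)] Fc[OF cont(1) UV(2)] Fb(1)[OF UV(2)]]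
        by simp
      moreover have "\<bar>green k2 (F N2 U) s - green k2 (F N2 V) s\<bar> \<le> c * dist U V / k2\<^sup>2"
        using green_bound[OF k(2) continuous_on_diff[OF Fc[OF cont(2) UV(1)] Fc[OF cont(2) UV(2)]] L2]
          green_diff[OF k(2) Fc[OF cont(2) UV(1)] Fb(2)[OF UV(1)] Fc[OF cont(2) UV(2)] Fb(2)[OF UV(2)]]
        by simp
      ultimately have "norm (T U s - T V s) \<le> dist U V / 2"
        using two[of "green k1 (F N1 U) s - green k1 (F N1 V) s" "dist U V"
            "green k2 (F N2 U) s - green k2 (F N2 V) s"]
          np[of "green k1 (F N1 U) s - green k1 (F N1 V) s" "green k2 (F N2 U) s - green k2 (F N2 V) s"]
        by (simp add: T_def)
      then show "dist (apply_bcontfun (TT U) s) (apply_bcontfun (TT V) s) \<le> 1 / 2 * dist U V"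
        using TT UV by (simp add: dist_norm)
    qed
  qed auto
  then obtain U where U: "U \<in> X" "TT U = U" by blast
  have eq: "apply_bcontfun U s = (green k1 (F N1 U) s, green k2 (F N2 U) s)" for s
    using TT[OF U(1)] U(2) by (simp add: T_def)
  obtain u' where u': "\<And>s. (green k1 (F N1 U) has_real_derivative u' s) (at s)"
    "\<And>s. (u' has_real_derivative k1\<^sup>2 * green k1 (F N1 U) s + F N1 U s) (at s)"
    using green_deriv[OF k(1) Fc[OF cont(1) U(1)] Fb(1)[OF U(1)]] by metis
  obtain v' where v': "\<And>s. (green k2 (F N2 U) has_real_derivative v' s) (at s)"
    "\<And>s. (v' has_real_derivative k2\<^sup>2 * green k2 (F N2 U) s + F N2 U s) (at s)"
    using green_deriv[OF k(2) Fc[OF cont(2) U(1)] Fb(2)[OF U(1)]] by metis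
  have FU: "F N U s = N s (green k1 (F N1 U) s, green k2 (F N2 U) s)" if "s \<ge> S" for N s
    unfolding F_def[of N] eq[symmetric] using that by (simp add: max_def)
  show thesis
  proof (rule that)
    show "norm (green k1 (F N1 U) s, green k2 (F N2 U) s) \<le> 1" for s
      using XD[OF U(1), of s] by (simp add: eq)
    show "(u' has_real_derivative k1\<^sup>2 * green k1 (F N1 U) s +
        N1 s (green k1 (F N1 U) s, green k2 (F N2 U) s)) (at s)" if "s \<ge> S" for s
      using u'(2)[of s] FU[OF that, of N1] by simp
    show "(v' has_real_derivative k2\<^sup>2 * green k2 (F N2 U) s +
        N2 s (green k1 (F N1 U) s, green k2 (F N2 U) s)) (at s)" if "s \<ge> S" for s
      using v'(2)[of s] FU[OF that, of N2] by simp
  qed (rule u' v')+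
qed

section \<open>The equations of motion\<close>

definition rad :: "real \<Rightarrow> real \<Rightarrow> real" where
  "rad R z = sqrt (R\<^sup>2 + 4 * z\<^sup>2)"

definition force_R :: "real \<Rightarrow> real \<Rightarrow> real \<Rightarrow> real \<Rightarrow> real \<Rightarrow> real \<Rightarrow> real \<Rightarrow> real \<Rightarrow> real" where
  "force_R M A A1 B B1 C R z = 2 * C\<^sup>2 / (M * R^3) - A / R^2 - 3 * B / R^4
     - 4 * A1 * R / rad R z ^ 3 - 48 * B1 * R / rad R z ^ 5"

definition force_z :: "real \<Rightarrow> real \<Rightarrow> real \<Rightarrow> real \<Rightarrow> real" where
  "force_z A1 B1 R z = - 16 * A1 * z / rad R z ^ 3 - 192 * B1 * z / rad R z ^ 5"

lemma rad_pos: "R > 0 \<Longrightarrow> rad R z > 0"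
  by (simp add: rad_def add_pos_nonneg)

lemma rad_sq_pos: "R > 0 \<Longrightarrow> R\<^sup>2 + 4 * z\<^sup>2 > 0" for R z :: real
  by (simp add: add_pos_nonneg)

lemma rad_scale: "c \<ge> 0 \<Longrightarrow> rad (c * R) (c * z) = c * rad R z"
proof -
  assume "c \<ge> 0"
  moreover have "(c * R)\<^sup>2 + 4 * (c * z)\<^sup>2 = c\<^sup>2 * (R\<^sup>2 + 4 * z\<^sup>2)"
    by (simp add: algebra_simps power_mult_distrib)
  ultimately show ?thesis
    by (simp add: rad_def real_sqrt_mult)
qed

lemma rad_deriv_R [derivative_intros]:
  assumes "R > 0" shows "((\<lambda>R. rad R z) has_real_derivative R / rad R z) (at R)"
  unfolding rad_def using rad_sq_pos[OF assms, of z]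
  by (auto intro!: derivative_eq_intros simp: field_simps)

lemma rad_deriv_z [derivative_intros]:
  assumes "R > 0" shows "((\<lambda>z. rad R z) has_real_derivative 4 * z / rad R z) (at z)"
  unfolding rad_def using rad_sq_pos[OF assms, of z]
  by (auto intro!: derivative_eq_intros simp: field_simps)

lemma H_red_rad:
  "H_red M m A A1 B B1 C R z PR Pz =
     1 / M * (PR^2 + C^2 / R^2) + (2*M + m) / (4*M*m) * Pz^2
     - A / R - B / R^3 - 4 * A1 / rad R z - 16 * B1 / rad R z ^ 3"
proof -
  have "(R\<^sup>2 + 4 * z\<^sup>2) powr (3/2) = ((R\<^sup>2 + 4 * z\<^sup>2) powr (1/2)) ^ 3"
    by (cases "R\<^sup>2 + 4 * z\<^sup>2 = 0") (simp_all add: powr_power)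
  then show ?thesis
    unfolding H_red_def rad_def by (simp add: powr_half_sqrt)
qed

lemma H_red_partials:
  assumes "M > 0" "m > 0" "R > 0"
  shows "deriv (\<lambda>p. H_red M m A A1 B B1 C R z p Pz) PR = 2 / M * PR"
    and "deriv (\<lambda>p. H_red M m A A1 B B1 C R z PR p) Pz = (2*M + m) / (2*M*m) * Pz"
    and "deriv (\<lambda>x. H_red M m A A1 B B1 C x z PR Pz) R = - force_R M A A1 B B1 C R z"
    and "deriv (\<lambda>y. H_red M m A A1 B B1 C R y PR Pz) z = - force_z A1 B1 R z"
proof -
  note [simp] = rad_pos[OF assms(3), of z, THEN less_imp_neq, symmetric]
    less_imp_neq[OF assms(1), symmetric] less_imp_neq[OF assms(2), symmetric] less_imp_neq[OF assms(3), symmetric]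
  show "deriv (\<lambda>p. H_red M m A A1 B B1 C R z p Pz) PR = 2 / M * PR"
    unfolding H_red_rad by (rule DERIV_imp_deriv) (auto intro!: derivative_eq_intros)
  show "deriv (\<lambda>p. H_red M m A A1 B B1 C R z PR p) Pz = (2*M + m) / (2*M*m) * Pz"
    unfolding H_red_rad by (rule DERIV_imp_deriv) (auto intro!: derivative_eq_intros simp: field_simps)
  show "deriv (\<lambda>x. H_red M m A A1 B B1 C x z PR Pz) R = - force_R M A A1 B B1 C R z"
    unfolding H_red_rad force_R_def using assms(3)
    by (intro DERIV_imp_deriv)
       (auto intro!: derivative_eq_intros simp: field_simps eval_nat_numeral)
  show "deriv (\<lambda>y. H_red M m A A1 B B1 C R y PR Pz) z = - force_z A1 B1 R z"
    unfolding H_red_rad force_z_def using assms(3)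
    by (intro DERIV_imp_deriv)
       (auto intro!: derivative_eq_intros simp: field_simps eval_nat_numeral)
qed

lemma solution_iff:
  assumes "M > 0" "m > 0"
  shows "solution M m A A1 B B1 C a b R z PR Pz \<longleftrightarrow>
     a < b \<and> (\<forall>t\<in>einterval a b. R t > 0 \<and>
        (R has_real_derivative 2 / M * PR t) (at t) \<and>
        (z has_real_derivative (2*M + m) / (2*M*m) * Pz t) (at t) \<and>
        (PR has_real_derivative force_R M A A1 B B1 C (R t) (z t)) (at t) \<and>
        (Pz has_real_derivative force_z A1 B1 (R t) (z t)) (at t))"
  unfolding solution_def using H_red_partials[OF assms]
  by (intro conj_cong refl ball_cong) auto

lemma einterval_nonempty: "a < b \<Longrightarrow> einterval a b \<noteq> {}"
  using ereal_dense2[of a b] einterval_iff by blast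

lemma has_real_derivative_cong_open:
  fixes f g :: "real \<Rightarrow> real"
  assumes "open S" "t \<in> S" "\<And>x. x \<in> S \<Longrightarrow> f x = g x"
  shows "(f has_real_derivative D) (at t) \<longleftrightarrow> (g has_real_derivative D) (at t)"
  by (rule DERIV_cong_ev) (use assms eventually_nhds_in_open[of S t] in \<open>auto elim!: eventually_mono\<close>)

section \<open>Extension to maximal solutions\<close>

text \<open>
  Solutions are compared through their graphs over the domain of definition: extending a solution then
  means enlarging its graph, and the union of a chain of solutions is the union of their graphs.
\<close>

definition trajectory :: "ereal \<Rightarrow> ereal \<Rightarrow> (real \<Rightarrow> real) \<Rightarrow> (real \<Rightarrow> real) \<Rightarrow> (real \<Rightarrow> real) \<Rightarrow>
    (real \<Rightarrow> real) \<Rightarrow> (real \<times> real \<times> real \<times> real \<times> real) set" where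
  "trajectory a b R z PR Pz = (\<lambda>t. (t, R t, z t, PR t, Pz t)) ` einterval a b"

lemma trajectory_subset_iff:
  "trajectory a b R z PR Pz \<subseteq> trajectory a' b' R' z' PR' Pz' \<longleftrightarrow>
     einterval a b \<subseteq> einterval a' b' \<and>
     (\<forall>t\<in>einterval a b. R' t = R t \<and> z' t = z t \<and> PR' t = PR t \<and> Pz' t = Pz t)"
  unfolding trajectory_def by fastforce

lemma einterval_subset_iff:
  assumes "a < b"
  shows "einterval a b \<subseteq> einterval a' b' \<longleftrightarrow> a' \<le> a \<and> b \<le> b'"
proof
  assume sub: "einterval a b \<subseteq> einterval a' b'"
  show "a' \<le> a \<and> b \<le> b'"
  proof (rule ccontr)
    assume "\<not> (a' \<le> a \<and> b \<le> b')"
    then consider "a < min a' b" | "max a b' < b"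
      using assms by (auto simp: min_def max_def not_le split: if_splits)
    then show False
    proof cases
      case 1
      then obtain t where "a < ereal t" "ereal t < min a' b" using ereal_dense2 by blast
      with sub show False by (auto simp: einterval_iff subset_iff)
    next
      case 2
      then obtain t where "max a b' < ereal t" "ereal t < b" using ereal_dense2 by blast
      with sub show False by (auto simp: einterval_iff subset_iff)
    qed
  qed
qed (auto simp: einterval_iff)

lemma solution_cong:
  assumes "solution M m A A1 B B1 C a b R z PR Pz" "M > 0" "m > 0"
    and "S \<subseteq> einterval a b" "open S" "t \<in> S"
    and "\<And>t. t \<in> S \<Longrightarrow> R' t = R t \<and> z' t = z t \<and> PR' t = PR t \<and> Pz' t = Pz t"
  shows "R' t > 0 \<and>
        (R' has_real_derivative 2 / M * PR' t) (at t) \<and>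
        (z' has_real_derivative (2*M + m) / (2*M*m) * Pz' t) (at t) \<and>
        (PR' has_real_derivative force_R M A A1 B B1 C (R' t) (z' t)) (at t) \<and>
        (Pz' has_real_derivative force_z A1 B1 (R' t) (z' t)) (at t)"
proof -
  have t: "t \<in> einterval a b" using assms by auto
  have "(R' has_real_derivative D) (at t) = (R has_real_derivative D) (at t)"
    "(z' has_real_derivative D) (at t) = (z has_real_derivative D) (at t)"
    "(PR' has_real_derivative D) (at t) = (PR has_real_derivative D) (at t)"
    "(Pz' has_real_derivative D) (at t) = (Pz has_real_derivative D) (at t)" for D
    by (rule has_real_derivative_cong_open[OF assms(5,6)]; use assms(7) in simp)+
  then show ?thesis
    using assms(1) assms(7)[OF assms(6)] t unfolding solution_iff[OF assms(2,3)] by simp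
qed

lemma solution_restrict:
  assumes "solution M m A A1 B B1 C a b R z PR Pz" "a \<le> a'" "b' \<le> b" "a' < b'"
  shows "solution M m A A1 B B1 C a' b' R z PR Pz"
proof -
  have "einterval a' b' \<subseteq> einterval a b"
    using assms by (simp add: einterval_subset_iff)
  with assms show ?thesis
    unfolding solution_def by blast
qed

text \<open>
  Any two members of the chain agree where both are defined, so the union is again the graph of a
  function; being a solution is a local property, and near each point the union is one of the members.
\<close>

lemma chain_union_trajectory:
  assumes pos: "M > 0" "m > 0"
    and chain: "subset.chain UNIV \<C>" and ne: "\<C> \<noteq> {}"
    and sol: "\<And>G. G \<in> \<C> \<Longrightarrow> \<exists>a b R z PR Pz. solution M m A A1 B B1 C a b R z PR Pz \<and>
      G = trajectory a b R z PR Pz"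
  shows "\<exists>a b R z PR Pz. solution M m A A1 B B1 C a b R z PR Pz \<and>
      \<Union>\<C> = trajectory a b R z PR Pz"
proof -
  obtain a b R z PR Pz where G: "solution M m A A1 B B1 C (a G) (b G) (R G) (z G) (PR G) (Pz G)"
    "G = trajectory (a G) (b G) (R G) (z G) (PR G) (Pz G)" if "G \<in> \<C>" for G
    using sol by metis
  define I where "I G = einterval (a G) (b G)" for G
  have ab: "a G < b G" if "G \<in> \<C>" for G
    using G(1)[OF that] by (simp add: solution_def)
  have agree: "R G t = R H t \<and> z G t = z H t \<and> PR G t = PR H t \<and> Pz G t = Pz H t"
    if "G \<in> \<C>" "H \<in> \<C>" "t \<in> I G" "t \<in> I H" for G H t
  proof -
    have "G \<subseteq> H \<or> H \<subseteq> G" using chain that by (auto simp: subset.chain_def)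
    then show ?thesis
      using trajectory_subset_iff[of "a G" "b G" "R G" "z G" "PR G" "Pz G"
          "a H" "b H" "R H" "z H" "PR H" "Pz H"]
        trajectory_subset_iff[of "a H" "b H" "R H" "z H" "PR H" "Pz H"
          "a G" "b G" "R G" "z G" "PR G" "Pz G"]
        that G(2) unfolding I_def by metis
  qed
  have nested: "(a H \<le> a G \<and> b G \<le> b H) \<or> (a G \<le> a H \<and> b H \<le> b G)"
    if "G \<in> \<C>" "H \<in> \<C>" for G H
  proof -
    have "G \<subseteq> H \<or> H \<subseteq> G" using chain that by (auto simp: subset.chain_def)
    then show ?thesis
      using trajectory_subset_iff[of "a G" "b G" "R G" "z G" "PR G" "Pz G"
          "a H" "b H" "R H" "z H" "PR H" "Pz H"]
        trajectory_subset_iff[of "a H" "b H" "R H" "z H" "PR H" "Pz H"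
          "a G" "b G" "R G" "z G" "PR G" "Pz G"]
        that G(2) einterval_subset_iff[OF ab] by metis
  qed
  define a0 b0 where "a0 = (INF G\<in>\<C>. a G)" and "b0 = (SUP G\<in>\<C>. b G)"
  have I0: "t \<in> einterval a0 b0 \<longleftrightarrow> (\<exists>G\<in>\<C>. t \<in> I G)" for t
  proof
    assume "t \<in> einterval a0 b0"
    then obtain G H where "G \<in> \<C>" "H \<in> \<C>" "a G < ereal t" "ereal t < b H"
      by (auto simp: a0_def b0_def einterval_iff INF_less_iff less_SUP_iff)
    with nested[of G H] show "\<exists>G\<in>\<C>. t \<in> I G"
      by (auto simp: I_def einterval_iff intro: less_le_trans le_less_trans)
  next
    assume "\<exists>G\<in>\<C>. t \<in> I G"
    then show "t \<in> einterval a0 b0"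
      by (auto simp: a0_def b0_def I_def einterval_iff INF_less_iff less_SUP_iff)
  qed
  define pick where "pick t = (SOME G. G \<in> \<C> \<and> t \<in> I G)" for t
  have pick: "pick t \<in> \<C> \<and> t \<in> I (pick t)" if "G \<in> \<C>" "t \<in> I G" for G t
    unfolding pick_def by (rule someI[of _ G]) (use that in auto)
  define R0 z0 PR0 Pz0 where "R0 t = R (pick t) t" and "z0 t = z (pick t) t"
    and "PR0 t = PR (pick t) t" and "Pz0 t = Pz (pick t) t" for t
  have eq: "R0 t = R G t \<and> z0 t = z G t \<and> PR0 t = PR G t \<and> Pz0 t = Pz G t"
    if "G \<in> \<C>" "t \<in> I G" for G t
    unfolding R0_def z0_def PR0_def Pz0_def using agree pick that by blast
  have "solution M m A A1 B B1 C a0 b0 R0 z0 PR0 Pz0"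
    unfolding solution_iff[OF pos]
  proof (intro conjI ballI)
    obtain G where "G \<in> \<C>" using ne by blast
    then have "a0 \<le> a G" "b G \<le> b0" by (auto simp: a0_def b0_def intro: INF_lower SUP_upper)
    with ab[OF \<open>G \<in> \<C>\<close>] show "a0 < b0" by order
  next
    fix t assume "t \<in> einterval a0 b0"
    then obtain H where H: "H \<in> \<C>" "t \<in> I H" using I0 by blast
    show "R0 t > 0"
        "(R0 has_real_derivative 2 / M * PR0 t) (at t)"
        "(z0 has_real_derivative (2*M + m) / (2*M*m) * Pz0 t) (at t)"
        "(PR0 has_real_derivative force_R M A A1 B B1 C (R0 t) (z0 t)) (at t)"
        "(Pz0 has_real_derivative force_z A1 B1 (R0 t) (z0 t)) (at t)"
      using solution_cong[OF G(1)[OF H(1)] pos, of "I H" t R0 z0 PR0 Pz0] eq[OF H(1)] H(2)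
      by (auto simp: I_def)
  qed
  moreover have "\<Union>\<C> = trajectory a0 b0 R0 z0 PR0 Pz0"
  proof -
    have "x \<in> \<Union>\<C> \<longleftrightarrow> x \<in> trajectory a0 b0 R0 z0 PR0 Pz0" for x
    proof -
      have "x \<in> \<Union>\<C> \<longleftrightarrow> (\<exists>G\<in>\<C>. \<exists>t\<in>I G. x = (t, R G t, z G t, PR G t, Pz G t))"
        using G(2) unfolding trajectory_def I_def by (metis (no_types, lifting) UnionE UnionI image_iff)
      also have "\<dots> \<longleftrightarrow> (\<exists>G\<in>\<C>. \<exists>t\<in>I G. x = (t, R0 t, z0 t, PR0 t, Pz0 t))"
        using eq by (intro bex_cong refl) auto
      also have "\<dots> \<longleftrightarrow> x \<in> trajectory a0 b0 R0 z0 PR0 Pz0"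
        unfolding trajectory_def using I0 by auto
      finally show ?thesis .
    qed
    then show ?thesis by blast
  qed
  ultimately show ?thesis by blast
qed

text \<open>
  Zorn's lemma for graphs of solutions. It replaces the usual gluing by uniqueness.
\<close>

lemma maximal_extension:
  assumes pos: "M > 0" "m > 0" and sol: "solution M m A A1 B B1 C a b R z PR Pz"
  obtains a' b' R' z' PR' Pz' where
    "maximal_solution M m A A1 B B1 C a' b' R' z' PR' Pz'" "a' \<le> a" "b \<le> b'"
    "\<And>t. t \<in> einterval a b \<Longrightarrow> R' t = R t \<and> z' t = z t \<and> PR' t = PR t \<and> Pz' t = Pz t"
proof -
  define \<S> where "\<S> = {G. trajectory a b R z PR Pz \<subseteq> G \<and>
    (\<exists>a b R z PR Pz. solution M m A A1 B B1 C a b R z PR Pz \<and> G = trajectory a b R z PR Pz)}"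
  have "\<exists>G\<in>\<S>. \<forall>X\<in>\<S>. G \<subseteq> X \<longrightarrow> X = G"
  proof (rule subset_Zorn_nonempty)
    show "\<S> \<noteq> {}" using sol unfolding \<S>_def by blast
    fix \<C> assume C: "\<C> \<noteq> {}" "subset.chain \<S> \<C>"
    then have "subset.chain UNIV \<C>" "\<C> \<subseteq> \<S>" by (auto simp: subset.chain_def)
    then have "\<exists>a b R z PR Pz. solution M m A A1 B B1 C a b R z PR Pz \<and>
        \<Union>\<C> = trajectory a b R z PR Pz"
      by (intro chain_union_trajectory[OF pos _ C(1)]) (auto simp: \<S>_def)
    moreover have "trajectory a b R z PR Pz \<subseteq> \<Union>\<C>"
      using C(1) \<open>\<C> \<subseteq> \<S>\<close> by (auto simp: \<S>_def)
    ultimately show "\<Union>\<C> \<in> \<S>" by (simp add: \<S>_def)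
  qed
  then obtain G where G: "G \<in> \<S>" and max: "\<And>X. X \<in> \<S> \<Longrightarrow> G \<subseteq> X \<Longrightarrow> X = G" by blast
  obtain a' b' R' z' PR' Pz' where s: "solution M m A A1 B B1 C a' b' R' z' PR' Pz'"
    and Geq: "G = trajectory a' b' R' z' PR' Pz'"
    using G unfolding \<S>_def by blast
  have ab: "a < b" "a' < b'" using sol s by (simp_all add: solution_def)
  have ext: "einterval a b \<subseteq> einterval a' b'"
    "\<And>t. t \<in> einterval a b \<Longrightarrow> R' t = R t \<and> z' t = z t \<and> PR' t = PR t \<and> Pz' t = Pz t"
    using G unfolding Geq \<S>_def mem_Collect_eq trajectory_subset_iff by blast+
  show thesis
  proof (rule that)
    show "maximal_solution M m A A1 B B1 C a' b' R' z' PR' Pz'"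
      unfolding maximal_solution_def
    proof (intro conjI s allI impI)
      fix a'' b'' R'' z'' PR'' Pz''
      assume le: "a'' \<le> a'" "b' \<le> b''"
        and s'': "solution M m A A1 B B1 C a'' b'' R'' z'' PR'' Pz''"
        and eq: "\<forall>t\<in>einterval a' b'. R'' t = R' t \<and> z'' t = z' t \<and> PR'' t = PR' t \<and> Pz'' t = Pz' t"
      have "G \<subseteq> trajectory a'' b'' R'' z'' PR'' Pz''"
        unfolding Geq trajectory_subset_iff using le eq einterval_subset_iff[OF ab(2)] by auto
      moreover from this have "trajectory a'' b'' R'' z'' PR'' Pz'' \<in> \<S>"
        using G s'' unfolding \<S>_def by blast
      ultimately have "trajectory a'' b'' R'' z'' PR'' Pz'' \<subseteq> trajectory a' b' R' z' PR' Pz'"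
        using max Geq by blast
      then have "einterval a'' b'' \<subseteq> einterval a' b'"
        by (simp add: trajectory_subset_iff)
      then show "a'' = a'" "b'' = b'"
        using le s'' einterval_subset_iff[of a'' b'' a' b'] by (auto simp: solution_def)
    qed
    show "a' \<le> a" "b \<le> b'"
      using ext(1) einterval_subset_iff[OF ab(1)] by auto
  qed (rule ext(2))
qed

text \<open>
  A solution existing beyond time 0 would be continuous there, and its \<open>R\<close> would be positive there,
  which contradicts the limit 0 from the left. So only the initial time moves in the extension.
\<close>

lemma triple_collision_extension:
  assumes pos: "M > 0" "m > 0" and T: "T > 0"
    and sol: "solution M m A A1 B B1 C (ereal (- T)) 0 R z PR Pz"
    and lim: "(R \<longlongrightarrow> 0) (at_left 0)" "(z \<longlongrightarrow> 0) (at_left 0)" "((\<lambda>t. z t / R t) \<longlongrightarrow> l) (at_left 0)"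
  obtains a R' z' PR' Pz' where "triple_collision_solution M m A A1 B B1 C a 0 R' z' PR' Pz'"
    "((\<lambda>t. z' t / R' t) \<longlongrightarrow> l) (at_left 0)"
proof -
  obtain a b R' z' PR' Pz' where
    max: "maximal_solution M m A A1 B B1 C a b R' z' PR' Pz'" and ab: "a \<le> ereal (- T)" "0 \<le> b"
    and eq: "\<And>t. t \<in> einterval (ereal (- T)) 0 \<Longrightarrow> R' t = R t \<and> z' t = z t \<and> PR' t = PR t \<and> Pz' t = Pz t"
    using maximal_extension[OF pos sol] by blast
  have "\<forall>\<^sub>F t in at_left 0. t \<in> einterval (ereal (- T)) 0"
    using T eventually_at_left_real[of "- T" 0] by (auto simp: einterval_iff elim!: eventually_mono)
  then have ev: "\<forall>\<^sub>F t in at_left 0. R' t = R t" "\<forall>\<^sub>F t in at_left 0. z' t = z t"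
    "\<forall>\<^sub>F t in at_left 0. z' t / R' t = z t / R t"
    by (eventually_elim, use eq in simp)+
  have lim': "(R' \<longlongrightarrow> 0) (at_left 0)" "(z' \<longlongrightarrow> 0) (at_left 0)"
    "((\<lambda>t. z' t / R' t) \<longlongrightarrow> l) (at_left 0)"
    using lim ev[THEN tendsto_cong] by simp_all
  have "b = 0"
  proof (rule ccontr)
    assume "b \<noteq> 0"
    then have "ereal 0 < b" using ab(2) by (metis less_le zero_ereal_def)
    moreover have "a < ereal 0"
      by (rule le_less_trans[OF ab(1)]) (use T in simp)
    ultimately have "0 \<in> einterval a b" by (simp add: einterval_iff)
    then have "R' 0 > 0" "\<exists>D. (R' has_real_derivative D) (at 0)"
      using max unfolding maximal_solution_def solution_def by blast+
    then have "isCont R' 0" using DERIV_isCont by blast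
    then have "(R' \<longlongrightarrow> R' 0) (at_left 0)"
      by (simp add: isCont_def filterlim_at_split)
    then have "R' 0 = 0" using tendsto_unique[OF _ _ lim'(1)] by simp
    with \<open>R' 0 > 0\<close> show False by simp
  qed
  with max have "triple_collision_solution M m A A1 B B1 C a 0 R' z' PR' Pz'"
    using lim' forward_end_ereal[of 0] by (simp add: triple_collision_solution_def zero_ereal_def)
  with lim'(3) show thesis by (rule that[rotated -1])
qed

section \<open>Homographic solutions\<close>

text \<open>
  The condition \<open>cB\<close> balances the terms of degree \<open>-4\<close> in the two accelerations along the ray. What
  remains of \<open>z'' = l R''\<close> is a relation \<open>\<alpha> / R\<^sup>2 = 2 C\<^sup>2 / (M R\<^sup>3)\<close> with \<open>\<alpha> \<noteq> 0\<close> by \<open>cA\<close>. So \<open>R\<close>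
  is constant, the forces vanish, and this is impossible because the vertical force on \<open>m\<close> always
  points strictly towards the plane.
\<close>

lemma no_solution_on_ray:
  fixes M m A A1 B B1 l :: real
  defines "\<sigma> \<equiv> sqrt (1 + 4 * l\<^sup>2)"
  assumes pos: "M > 0" "m > 0" "A1 > 0" "B1 > 0"
    and l: "l \<noteq> 0"
    and cB: "B * \<sigma>^5 = 16 * B1 * (2 * M / m)"
    and cA: "A * \<sigma>^3 \<noteq> 4 * A1 * (2 * M / m)"
    and sol: "solution M m A A1 B B1 C a b R z PR Pz"
    and ray: "\<And>t. t \<in> einterval a b \<Longrightarrow> z t = l * R t"
  shows False
proof -
  define I where "I = einterval a b"
  note ray = ray[folded I_def]
  have I: "open I" "I \<noteq> {}"
    using sol einterval_nonempty by (auto simp: I_def solution_def)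
  have s: "\<sigma> > 0" by (simp add: \<sigma>_def add_pos_nonneg)
  have S: "R t > 0" "(R has_real_derivative 2 / M * PR t) (at t)"
      "(z has_real_derivative (2*M + m) / (2*M*m) * Pz t) (at t)"
      "(PR has_real_derivative force_R M A A1 B B1 C (R t) (z t)) (at t)"
      "(Pz has_real_derivative force_z A1 B1 (R t) (z t)) (at t)" if "t \<in> I" for t
    using sol that pos by (auto simp: solution_iff I_def)
  have P: "(2*M + m) / (2*M*m) * Pz t = l * (2 / M * PR t)" if t: "t \<in> I" for t
  proof -
    have "(z has_real_derivative l * (2 / M * PR t)) (at t)"
      using has_real_derivative_cong_open[OF I(1) t, of z "\<lambda>t. l * R t"] ray
        DERIV_cmult[OF S(2)[OF t], of l] by auto
    with S(3)[OF t] show ?thesis by (rule DERIV_unique)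
  qed
  have F: "(2*M + m) / (2*M*m) * force_z A1 B1 (R t) (z t) = l * (2 / M * force_R M A A1 B B1 C (R t) (z t))"
    if t: "t \<in> I" for t
  proof -
    have "((\<lambda>t. (2*M + m) / (2*M*m) * Pz t) has_real_derivative
        l * (2 / M * force_R M A A1 B B1 C (R t) (z t))) (at t)"
      using has_real_derivative_cong_open[OF I(1) t, of "\<lambda>t. (2*M + m) / (2*M*m) * Pz t"
          "\<lambda>t. l * (2 / M * PR t)"] P
        DERIV_cmult[OF DERIV_cmult[OF S(4)[OF t], of "2 / M"], of l] by auto
    moreover have "((\<lambda>t. (2*M + m) / (2*M*m) * Pz t) has_real_derivative
        (2*M + m) / (2*M*m) * force_z A1 B1 (R t) (z t)) (at t)"
      by (rule DERIV_cmult) (rule S(5)[OF t])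
    ultimately show ?thesis by (metis DERIV_unique)
  qed
  have rad: "rad (R t) (z t) = \<sigma> * R t" if "t \<in> I" for t
    using rad_scale[of "R t" 1 l] S(1)[OF that] ray that
    by (simp add: mult.commute rad_def \<sigma>_def)
  define \<alpha> where "\<alpha> = A - 4 * A1 * (2 * M / m) / \<sigma>^3"
  have \<alpha>: "\<alpha> \<noteq> 0"
    using cA s pos by (simp add: \<alpha>_def field_simps)
  have B: "B = 16 * B1 * (2 * M / m) / \<sigma>^5"
    using cB s pos by (simp add: field_simps)
  have R: "R t = 2 * C\<^sup>2 / (M * \<alpha>)" if t: "t \<in> I" for t
  proof -
    define r where "r = R t"
    have r: "r > 0" using S(1)[OF t] by (simp add: r_def)
    have z: "z t = l * r" using ray t by (simp add: r_def)
    have "(2*M + m) / (2*M*m) * (- 16 * A1 / (\<sigma>^3 * r^2) - 192 * B1 / (\<sigma>^5 * r^4))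
      = 2 / M * (2 * C\<^sup>2 / (M * r^3) - A / r^2 - 3 * B / r^4 - 4 * A1 / (\<sigma>^3 * r^2)
          - 48 * B1 / (\<sigma>^5 * r^4))" (is "?a = ?b")
    proof -
      have q: "r / (\<sigma> * r)^3 = 1 / (\<sigma>^3 * r^2)" "r / (\<sigma> * r)^5 = 1 / (\<sigma>^5 * r^4)"
        using r s by (simp_all add: power_mult_distrib divide_simps eval_nat_numeral)
      have "force_z A1 B1 (R t) (z t) = l * (- 16 * A1 * (r / (\<sigma> * r)^3) - 192 * B1 * (r / (\<sigma> * r)^5))"
        unfolding force_z_def rad[OF t] unfolding z r_def[symmetric] by (simp add: algebra_simps)
      moreover have "force_R M A A1 B B1 C (R t) (z t) = 2 * C\<^sup>2 / (M * r^3) - A / r^2 - 3 * B / r^4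
          - 4 * A1 * (r / (\<sigma> * r)^3) - 48 * B1 * (r / (\<sigma> * r)^5)"
        unfolding force_R_def rad[OF t] unfolding r_def[symmetric] by simp
      ultimately have "l * ?a = l * ?b"
        using F[OF t] unfolding q by (simp only: mult.left_commute mult_1_right times_divide_eq_right)
      then show ?thesis
        using l by (simp only: mult_left_cancel not_False_eq_True)
    qed
    moreover have "?a = 2 / M * - ((2*M/m + 1) * (4 * A1 / (\<sigma>^3 * r^2) + 48 * B1 / (\<sigma>^5 * r^4)))"
      using pos r s by (simp add: field_simps)
    ultimately have "- ((2*M/m + 1) * (4 * A1 / (\<sigma>^3 * r^2) + 48 * B1 / (\<sigma>^5 * r^4)))
      = 2 * C\<^sup>2 / (M * r^3) - A / r^2 - 3 * B / r^4 - 4 * A1 / (\<sigma>^3 * r^2)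
          - 48 * B1 / (\<sigma>^5 * r^4)"
      using pos mult_left_cancel[of "2 / M"] by (metis divide_eq_0_iff less_irrefl zero_neq_numeral)
    moreover have "3 * B / r^4 = 2 * M / m * (48 * B1 / (\<sigma>^5 * r^4))"
      unfolding B by (simp add: mult_ac)
    moreover have "\<alpha> / r^2 = A / r^2 - 2 * M / m * (4 * A1 / (\<sigma>^3 * r^2))"
      unfolding \<alpha>_def by (simp add: diff_divide_distrib mult_ac)
    moreover have "c = w" if "- ((k + 1) * (a + b)) = c - x - y - a - b" "y = k * b" "w = x - k * a"
      for a b c k w x y :: real
      using that by (simp add: algebra_simps)
    ultimately have "2 * C\<^sup>2 / (M * r^3) = \<alpha> / r^2"
      by blast
    then show ?thesis
      using r \<alpha> pos unfolding r_def[symmetric] by (simp add: field_simps eval_nat_numeral)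
  qed
  from I(2) obtain t where t: "t \<in> I" by blast
  have PR0: "PR u = 0" if u: "u \<in> I" for u
  proof -
    have "(R has_real_derivative 0) (at u)"
      using has_real_derivative_cong_open[OF I(1) u, of R "\<lambda>_. 2 * C\<^sup>2 / (M * \<alpha>)"] R by auto
    with S(2)[OF u] have "2 / M * PR u = 0" by (rule DERIV_unique)
    then show ?thesis using pos by simp
  qed
  have "(PR has_real_derivative 0) (at t)"
    using has_real_derivative_cong_open[OF I(1) t, of PR "\<lambda>_. 0"] PR0 by auto
  with S(4)[OF t] have "force_R M A A1 B B1 C (R t) (z t) = 0" by (rule DERIV_unique)
  with F[OF t] pos have "force_z A1 B1 (R t) (z t) = 0"
    by (simp add: add_pos_pos) 
  moreover have "force_z A1 B1 (R t) (z t) = - z t * (16 * A1 / (\<sigma> * R t)^3 + 192 * B1 / (\<sigma> * R t)^5)"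
    by (simp add: force_z_def rad[OF t] field_simps)
  moreover have "16 * A1 / (\<sigma> * R t)^3 + 192 * B1 / (\<sigma> * R t)^5 > 0"
    using pos s S(1)[OF t] by (intro add_pos_pos divide_pos_pos) auto
  moreover have "z t \<noteq> 0" using ray t l S(1)[OF t] by simp
  ultimately show False by simp
qed

lemma rotation_norm:
  assumes "vertical_rotation Q"
  shows "norm (Q *v x) = norm x"
proof -
  have "orthogonal_transformation ((*v) Q)"
    using assms
    by (simp add: vertical_rotation_def rotation_matrix_def orthogonal_transformation_matrix)
  then show ?thesis by (rule orthogonal_transformation_norm)
qed

text \<open>
  Rotations preserve the length of the horizontal vector, so \<open>R\<close> and \<open>\<bar>z\<bar>\<close> are both multiples of
  \<open>\<bar>\<phi>\<bar>\<close>. The absolute value is needed because \<open>\<phi>\<close> is not assumed to be continuous and could change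
  sign.
\<close>

lemma homographic_ratio:
  assumes "homographic_solution M m A A1 B B1 C a b R z PR Pz"
  obtains k where "\<And>t. t \<in> einterval a b \<Longrightarrow> \<bar>z t / R t\<bar> = k"
proof -
  obtain r1 r2 where lift: "jacobi_lift M C (einterval a b) R z r1 r2"
    and motion: "homographic_motion (einterval a b) r1 r2"
    using assms unfolding homographic_solution_def by blast
  from lift obtain th where
    r1: "\<And>t. t \<in> einterval a b \<Longrightarrow> r1 t = R t *\<^sub>R vector [cos (th t), sin (th t), 0]"
    and r2: "\<And>t. t \<in> einterval a b \<Longrightarrow> r2 t = vector [0, 0, z t]"
    unfolding jacobi_lift_def by blast
  from motion obtain \<phi> \<Omega> a1 a2 where
    h: "\<And>t. t \<in> einterval a b \<Longrightarrow> \<phi> t \<noteq> 0 \<and> vertical_rotation (\<Omega> t) \<and>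
      r1 t = \<phi> t *\<^sub>R (\<Omega> t *v a1) \<and> r2 t = \<phi> t *\<^sub>R a2"
    unfolding homographic_motion_def by blast
  show thesis
  proof (rule that)
    fix t assume t: "t \<in> einterval a b"
    have "R t > 0"
      using assms t by (auto simp: homographic_solution_def solution_def)
    moreover have "norm (vector [cos (th t), sin (th t), 0] :: real^3) = 1"
      by (simp add: norm_eq_sqrt_inner inner_vec_def sum_3 flip: power2_eq_square)
    ultimately have "R t = norm (r1 t)"
      using r1[OF t] by simp
    also have "\<dots> = \<bar>\<phi> t\<bar> * norm a1"
      using h[OF t] rotation_norm by simp
    finally have R: "R t = \<bar>\<phi> t\<bar> * norm a1" .
    have "z t = r2 t $ 3" using r2[OF t] by simp
    then have "z t = \<phi> t * a2 $ 3" using h[OF t] by simp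
    then show "\<bar>z t / R t\<bar> = \<bar>a2 $ 3\<bar> / norm a1"
      using h[OF t] by (simp add: R abs_divide abs_mult)
  qed
qed

text \<open>
  The constant value of \<open>\<bar>z / R\<bar>\<close> must be \<open>\<bar>l\<bar>\<close>, and near the collision the sign of \<open>z / R\<close> is that
  of \<open>l\<close>; hence the last part of the solution lies on the ray.
\<close>

lemma homographic_limit_ray:
  assumes hom: "homographic_solution M m A A1 B B1 C a 0 R z PR Pz"
    and pos: "M > 0" "m > 0" "A1 > 0" "B1 > 0" and l: "l \<noteq> 0"
    and cB: "B * sqrt (1 + 4 * l\<^sup>2)^5 = 16 * B1 * (2 * M / m)"
    and cA: "A * sqrt (1 + 4 * l\<^sup>2)^3 \<noteq> 4 * A1 * (2 * M / m)"
    and lim: "((\<lambda>t. z t / R t) \<longlongrightarrow> l) (at_left 0)"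
  shows False
proof -
  have sol: "solution M m A A1 B B1 C a 0 R z PR Pz"
    using hom by (simp add: homographic_solution_def)
  have a: "a < 0" using sol by (simp add: solution_def)
  obtain k where k: "\<And>t. t \<in> einterval a 0 \<Longrightarrow> \<bar>z t / R t\<bar> = k"
    using homographic_ratio[OF hom] by blast
  obtain a0 where a0: "a < ereal a0" "ereal a0 < 0" using ereal_dense2[OF a] by blast
  have in_I: "t \<in> einterval a 0" if "a0 < t" "t < 0" for t
    using that a0 by (auto simp: einterval_iff intro: less_trans)
  have "\<forall>\<^sub>F t in at_left 0. a0 < t \<and> t < 0"
    using a0 eventually_at_left_real[of a0 0] by (auto elim!: eventually_mono)
  then have "\<forall>\<^sub>F t in at_left 0. \<bar>z t / R t\<bar> = k"
    by eventually_elim (use k in_I in blast)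
  then have "((\<lambda>t. \<bar>z t / R t\<bar>) \<longlongrightarrow> k) (at_left 0)"
    by (rule tendsto_eventually)
  then have kl: "k = \<bar>l\<bar>"
    using tendsto_unique[OF _ _ tendsto_rabs[OF lim]] by simp
  have "\<forall>\<^sub>F t in at_left 0. dist (z t / R t) l < \<bar>l\<bar>"
    using tendstoD[OF lim, of "\<bar>l\<bar>"] l by simp
  then obtain b0 where b0: "b0 < 0" "\<And>t. b0 < t \<Longrightarrow> t < 0 \<Longrightarrow> dist (z t / R t) l < \<bar>l\<bar>"
    unfolding eventually_at_left_field by blast
  define c where "c = max a0 b0"
  have c: "c < 0" using a0 b0 by (simp add: c_def)
  have ray: "z t = l * R t" if "t \<in> einterval (ereal c) 0" for t
  proof -
    have t: "a0 < t" "b0 < t" "t < 0" using that by (auto simp: einterval_iff c_def)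
    have "\<bar>z t / R t\<bar> = \<bar>l\<bar>" "dist (z t / R t) l < \<bar>l\<bar>"
      using k[OF in_I[OF t(1,3)]] kl b0(2)[OF t(2,3)] by auto
    then have "z t / R t = l" by (auto simp: dist_real_def abs_if split: if_splits)
    moreover have "R t > 0" using sol in_I[OF t(1,3)] by (auto simp: solution_def)
    ultimately show ?thesis by (simp add: field_simps)
  qed
  have "solution M m A A1 B B1 C (ereal c) 0 R z PR Pz"
    using a0 c by (intro solution_restrict[OF sol]) (auto simp: c_def intro: less_imp_le order_trans less_le_trans)
  from no_solution_on_ray[OF pos l cB cA this ray] show False .
qed

section \<open>Strict differentiability and homogeneous force fields\<close>

text \<open>
  Strict differentiability, with gradient \<open>(a, b)\<close>. It says that near the point the function minus its
  linear part has an arbitrarily small Lipschitz constant, which is what the contraction needs.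
\<close>

definition strictly_differentiable ::
    "(real \<Rightarrow> real \<Rightarrow> real) \<Rightarrow> real \<Rightarrow> real \<Rightarrow> real \<Rightarrow> real \<Rightarrow> bool" where
  "strictly_differentiable F x0 y0 a b \<longleftrightarrow>
     (\<forall>\<eta>>0. \<exists>d>0. \<forall>x y x' y'. \<bar>x - x0\<bar> \<le> d \<longrightarrow> \<bar>y - y0\<bar> \<le> d \<longrightarrow> \<bar>x' - x0\<bar> \<le> d \<longrightarrow> \<bar>y' - y0\<bar> \<le> d \<longrightarrow>
       \<bar>F x y - F x' y' - (a * (x - x') + b * (y - y'))\<bar> \<le> \<eta> * (\<bar>x - x'\<bar> + \<bar>y - y'\<bar>))"

text \<open>
  Mean value theorem along the two sides of a rectangle, applied to \<open>F\<close> minus its linear part.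
\<close>

lemma strictly_differentiable_partials:
  fixes F Fx Fy :: "real \<Rightarrow> real \<Rightarrow> real"
  assumes x0: "x0 > 0"
    and Fx: "\<And>x y. x > 0 \<Longrightarrow> ((\<lambda>x. F x y) has_real_derivative Fx x y) (at x)"
    and Fy: "\<And>x y. x > 0 \<Longrightarrow> ((\<lambda>y. F x y) has_real_derivative Fy x y) (at y)"
    and cont: "continuous_on ({0<..} \<times> UNIV) (\<lambda>p. Fx (fst p) (snd p))"
      "continuous_on ({0<..} \<times> UNIV) (\<lambda>p. Fy (fst p) (snd p))"
  shows "strictly_differentiable F x0 y0 (Fx x0 y0) (Fy x0 y0)"
  unfolding strictly_differentiable_def
proof (intro allI impI)
  fix \<eta> :: real assume \<eta>: "\<eta> > 0"
  have "open ({0<..} \<times> (UNIV :: real set) :: (real \<times> real) set)"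
    by (intro open_Times) auto
  then have c: "isCont (\<lambda>p. Fx (fst p) (snd p)) (x0, y0)" "isCont (\<lambda>p. Fy (fst p) (snd p)) (x0, y0)"
    using cont x0 by (auto simp: continuous_on_eq_continuous_at)
  obtain d1 where d1: "d1 > 0" "\<And>p. dist p (x0, y0) < d1 \<Longrightarrow> \<bar>Fx (fst p) (snd p) - Fx x0 y0\<bar> < \<eta>"
    using c(1) \<eta> unfolding continuous_at_eps_delta by (auto simp: dist_real_def)
  obtain d2 where d2: "d2 > 0" "\<And>p. dist p (x0, y0) < d2 \<Longrightarrow> \<bar>Fy (fst p) (snd p) - Fy x0 y0\<bar> < \<eta>"
    using c(2) \<eta> unfolding continuous_at_eps_delta by (auto simp: dist_real_def)
  define d where "d = min (x0 / 2) (min d1 d2 / 3)"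
  have d: "d > 0" "d < x0" "2 * d < d1" "2 * d < d2"
    using x0 d1 d2 by (auto simp: d_def)
  have box: "dist (x, y) (x0, y0) \<le> 2 * d" if "\<bar>x - x0\<bar> \<le> d" "\<bar>y - y0\<bar> \<le> d" for x y
    using norm_Pair_le[of "x - x0" "y - y0"] that by (simp add: dist_norm)
  have bd: "\<bar>Fx x y - Fx x0 y0\<bar> \<le> \<eta>" "\<bar>Fy x y - Fy x0 y0\<bar> \<le> \<eta>"
    if "\<bar>x - x0\<bar> \<le> d" "\<bar>y - y0\<bar> \<le> d" for x y
    using d1(2)[of "(x, y)"] d2(2)[of "(x, y)"] box[OF that] d by auto
  show "\<exists>d>0. \<forall>x y x' y'. \<bar>x - x0\<bar> \<le> d \<longrightarrow> \<bar>y - y0\<bar> \<le> d \<longrightarrow> \<bar>x' - x0\<bar> \<le> d \<longrightarrow> \<bar>y' - y0\<bar> \<le> d \<longrightarrow>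
      \<bar>F x y - F x' y' - (Fx x0 y0 * (x - x') + Fy x0 y0 * (y - y'))\<bar> \<le> \<eta> * (\<bar>x - x'\<bar> + \<bar>y - y'\<bar>)"
  proof (intro exI[of _ d] conjI d(1) allI impI)
    fix x y x' y' assume xy: "\<bar>x - x0\<bar> \<le> d" "\<bar>y - y0\<bar> \<le> d" "\<bar>x' - x0\<bar> \<le> d" "\<bar>y' - y0\<bar> \<le> d"
    have "norm ((F x y - Fx x0 y0 * x) - (F x' y - Fx x0 y0 * x')) \<le> \<eta> * norm (x - x')"
    proof (rule field_differentiable_bound[where S = "cball x0 d" and f = "\<lambda>x. F x y - Fx x0 y0 * x"
          and f' = "\<lambda>x. Fx x y - Fx x0 y0"])
      fix w assume w: "w \<in> cball x0 d"
      then have "w > 0" using d by (auto simp: dist_real_def)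
      then show "((\<lambda>x. F x y - Fx x0 y0 * x) has_real_derivative Fx w y - Fx x0 y0) (at w within cball x0 d)"
        by (auto intro!: derivative_eq_intros has_field_derivative_at_within[OF Fx])
      show "norm (Fx w y - Fx x0 y0) \<le> \<eta>"
        using w bd(1)[of w y] xy by (auto simp: dist_real_def abs_minus_commute)
    qed (use xy in \<open>auto simp: dist_real_def abs_minus_commute\<close>)
    moreover have "norm ((F x' y - Fy x0 y0 * y) - (F x' y' - Fy x0 y0 * y')) \<le> \<eta> * norm (y - y')"
    proof (rule field_differentiable_bound[where S = "cball y0 d" and f = "\<lambda>y. F x' y - Fy x0 y0 * y"
          and f' = "\<lambda>y. Fy x' y - Fy x0 y0"])
      fix w assume w: "w \<in> cball y0 d"
      have "x' > 0" using d xy by (auto simp: dist_real_def)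
      then show "((\<lambda>y. F x' y - Fy x0 y0 * y) has_real_derivative Fy x' w - Fy x0 y0) (at w within cball y0 d)"
        by (auto intro!: derivative_eq_intros has_field_derivative_at_within[OF Fy])
      show "norm (Fy x' w - Fy x0 y0) \<le> \<eta>"
        using w bd(2)[of x' w] xy by (auto simp: dist_real_def abs_minus_commute)
    qed (use xy in \<open>auto simp: dist_real_def abs_minus_commute\<close>)
    ultimately show "\<bar>F x y - F x' y' - (Fx x0 y0 * (x - x') + Fy x0 y0 * (y - y'))\<bar>
        \<le> \<eta> * (\<bar>x - x'\<bar> + \<bar>y - y'\<bar>)"
      by (simp add: algebra_simps)
  qed
qed

lemma strictly_differentiable_add_linear:
  assumes "strictly_differentiable F x0 y0 a b"
  shows "strictly_differentiable (\<lambda>x y. k * x + l * y + F x y) x0 y0 (k + a) (l + b)"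
proof -
  have eq: "k * x + l * y + F x y - (k * x' + l * y' + F x' y') - ((k + a) * (x - x') + (l + b) * (y - y'))
      = F x y - F x' y' - (a * (x - x') + b * (y - y'))" for x y x' y'
    by (simp add: algebra_simps)
  from assms show ?thesis
    by (simp only: strictly_differentiable_def eq)
qed

lemma strictly_differentiable_lipschitz:
  assumes "strictly_differentiable F x0 y0 a b"
  obtains d where "d > 0" "\<And>x y x' y'. \<bar>x - x0\<bar> \<le> d \<Longrightarrow> \<bar>y - y0\<bar> \<le> d \<Longrightarrow> \<bar>x' - x0\<bar> \<le> d \<Longrightarrow> \<bar>y' - y0\<bar> \<le> d
     \<Longrightarrow> \<bar>F x y - F x' y'\<bar> \<le> (\<bar>a\<bar> + \<bar>b\<bar> + 1) * (\<bar>x - x'\<bar> + \<bar>y - y'\<bar>)"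
proof -
  obtain d where d: "d > 0" "\<And>x y x' y'. \<bar>x - x0\<bar> \<le> d \<Longrightarrow> \<bar>y - y0\<bar> \<le> d \<Longrightarrow> \<bar>x' - x0\<bar> \<le> d \<Longrightarrow> \<bar>y' - y0\<bar> \<le> d
     \<Longrightarrow> \<bar>F x y - F x' y' - (a * (x - x') + b * (y - y'))\<bar> \<le> 1 * (\<bar>x - x'\<bar> + \<bar>y - y'\<bar>)"
    using assms unfolding strictly_differentiable_def by (meson zero_less_one)
  have bound: "\<bar>u\<bar> \<le> \<bar>w\<bar> + c" if "\<bar>u - w\<bar> \<le> c" for u w c :: real
    using that by linarith
  show thesis
  proof (rule that[OF d(1)])
    fix x y x' y' assume "\<bar>x - x0\<bar> \<le> d" "\<bar>y - y0\<bar> \<le> d" "\<bar>x' - x0\<bar> \<le> d" "\<bar>y' - y0\<bar> \<le> d"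
    from d(2)[OF this]
    have "\<bar>F x y - F x' y'\<bar> \<le> \<bar>a * (x - x') + b * (y - y')\<bar> + (\<bar>x - x'\<bar> + \<bar>y - y'\<bar>)"
      unfolding mult_1 by (rule bound)
    also have "\<bar>a * (x - x') + b * (y - y')\<bar> \<le> \<bar>a\<bar> * \<bar>x - x'\<bar> + \<bar>b\<bar> * \<bar>y - y'\<bar>"
      by (metis abs_mult abs_triangle_ineq)
    also have "\<dots> \<le> (\<bar>a\<bar> + \<bar>b\<bar>) * (\<bar>x - x'\<bar> + \<bar>y - y'\<bar>)"
      by (simp add: algebra_simps)
    finally show "\<bar>F x y - F x' y'\<bar> \<le> (\<bar>a\<bar> + \<bar>b\<bar> + 1) * (\<bar>x - x'\<bar> + \<bar>y - y'\<bar>)"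
      by (simp add: algebra_simps)
  qed
qed

text \<open>
  The nonlinearity of the rescaled equations, with \<open>\<epsilon> = exp (- s / 10)\<close>: the fields \<open>g\<close>, \<open>h3\<close>,
  \<open>h2\<close> come from the forces of degree \<open>-4\<close>, \<open>-3\<close>, \<open>-2\<close>. In the scale \<open>\<tau>\<^bsup>2/5\<^esup> = \<epsilon>\<^sup>4\<close> of the
  collision, each degree above \<open>-4\<close> contributes a factor \<open>\<epsilon>\<^sup>4\<close>.
\<close>

definition remainder where
  "remainder g h3 h2 x0 y0 a b \<epsilon> p q =
     (g (x0 + \<epsilon> * p) (y0 + \<epsilon> * q) + \<epsilon>^4 * h3 (x0 + \<epsilon> * p) (y0 + \<epsilon> * q)
      + \<epsilon>^8 * h2 (x0 + \<epsilon> * p) (y0 + \<epsilon> * q)) / \<epsilon> - (a * p + b * q)" for x0 y0 a b \<epsilon> p q :: real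

text \<open>
  The part of degree \<open>-4\<close> is controlled by strict differentiability at \<open>(x0, y0)\<close>, the other two
  by their powers of \<open>\<epsilon>\<close>, of which the division removes only one.
\<close>

lemma remainder_small:
  assumes g: "strictly_differentiable g x0 y0 a b" "g x0 y0 = 0"
    and h3: "strictly_differentiable h3 x0 y0 a3 b3"
    and h2: "strictly_differentiable h2 x0 y0 a2 b2"
    and e: "e > 0" and K: "K \<ge> 0"
  obtains \<epsilon>0 where "\<epsilon>0 > 0"
    "\<And>\<epsilon> p q. 0 < \<epsilon> \<Longrightarrow> \<epsilon> \<le> \<epsilon>0 \<Longrightarrow> \<bar>p\<bar> \<le> K \<Longrightarrow> \<bar>q\<bar> \<le> K \<Longrightarrow>
       \<bar>remainder g h3 h2 x0 y0 a b \<epsilon> p q\<bar> \<le> e"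
    "\<And>\<epsilon> p q p' q'. 0 < \<epsilon> \<Longrightarrow> \<epsilon> \<le> \<epsilon>0 \<Longrightarrow> \<bar>p\<bar> \<le> K \<Longrightarrow> \<bar>q\<bar> \<le> K \<Longrightarrow> \<bar>p'\<bar> \<le> K \<Longrightarrow> \<bar>q'\<bar> \<le> K \<Longrightarrow>
       \<bar>remainder g h3 h2 x0 y0 a b \<epsilon> p q - remainder g h3 h2 x0 y0 a b \<epsilon> p' q'\<bar> \<le>
         e * (\<bar>p - p'\<bar> + \<bar>q - q'\<bar>)"
proof -
  define \<eta> where "\<eta> = e / (4 * (1 + 2 * K))"
  have \<eta>: "\<eta> > 0" using e K by (simp add: \<eta>_def)
  have \<eta>': "2 * \<eta> * (1 + 2 * K) = e / 2" using K by (simp add: \<eta>_def field_simps)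
  obtain d1 where d1: "d1 > 0" "\<And>x y x' y'. \<bar>x - x0\<bar> \<le> d1 \<Longrightarrow> \<bar>y - y0\<bar> \<le> d1 \<Longrightarrow> \<bar>x' - x0\<bar> \<le> d1 \<Longrightarrow> \<bar>y' - y0\<bar> \<le> d1
     \<Longrightarrow> \<bar>g x y - g x' y' - (a * (x - x') + b * (y - y'))\<bar> \<le> \<eta> * (\<bar>x - x'\<bar> + \<bar>y - y'\<bar>)"
    using g(1) \<eta> unfolding strictly_differentiable_def by meson
  obtain d2 where d2: "d2 > 0" "\<And>x y x' y'. \<bar>x - x0\<bar> \<le> d2 \<Longrightarrow> \<bar>y - y0\<bar> \<le> d2 \<Longrightarrow> \<bar>x' - x0\<bar> \<le> d2 \<Longrightarrow> \<bar>y' - y0\<bar> \<le> d2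
     \<Longrightarrow> \<bar>h3 x y - h3 x' y'\<bar> \<le> (\<bar>a3\<bar> + \<bar>b3\<bar> + 1) * (\<bar>x - x'\<bar> + \<bar>y - y'\<bar>)"
    using strictly_differentiable_lipschitz[OF h3] by metis
  obtain d3 where d3: "d3 > 0" "\<And>x y x' y'. \<bar>x - x0\<bar> \<le> d3 \<Longrightarrow> \<bar>y - y0\<bar> \<le> d3 \<Longrightarrow> \<bar>x' - x0\<bar> \<le> d3 \<Longrightarrow> \<bar>y' - y0\<bar> \<le> d3
     \<Longrightarrow> \<bar>h2 x y - h2 x' y'\<bar> \<le> (\<bar>a2\<bar> + \<bar>b2\<bar> + 1) * (\<bar>x - x'\<bar> + \<bar>y - y'\<bar>)"
    using strictly_differentiable_lipschitz[OF h2] by metis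
  define L where "L = 2 + \<bar>a3\<bar> + \<bar>b3\<bar> + \<bar>a2\<bar> + \<bar>b2\<bar> + \<bar>h3 x0 y0\<bar> + \<bar>h2 x0 y0\<bar>"
  have L: "L > 0" by (simp add: L_def)
  \<comment> \<open>the third bound keeps \<open>(x0 + \<epsilon> p, y0 + \<epsilon> q)\<close> in the neighbourhoods of the three estimates\<close>
  define \<epsilon>0 where "\<epsilon>0 = min 1 (min (\<eta> / L) (min d1 (min d2 d3) / (K + 1)))"
  let ?N = "remainder g h3 h2 x0 y0 a b"
  have small: "0 < \<epsilon>" "\<epsilon> \<le> 1" "\<epsilon> * L \<le> \<eta>" "\<And>p. \<bar>p\<bar> \<le> K \<Longrightarrow> \<bar>\<epsilon> * p\<bar> \<le> min d1 (min d2 d3)"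
    if "0 < \<epsilon>" "\<epsilon> \<le> \<epsilon>0" for \<epsilon>
  proof -
    show "0 < \<epsilon>" "\<epsilon> \<le> 1" using that by (auto simp: \<epsilon>0_def)
    have "\<epsilon> \<le> \<eta> / L" using that by (auto simp: \<epsilon>0_def)
    then show "\<epsilon> * L \<le> \<eta>" using L by (simp add: field_simps)
    fix p assume p: "\<bar>p\<bar> \<le> K"
    have "\<epsilon> \<le> min d1 (min d2 d3) / (K + 1)" using that by (simp add: \<epsilon>0_def)
    then have "\<epsilon> * (K + 1) \<le> min d1 (min d2 d3)"
      using K by (subst (asm) pos_le_divide_eq) auto
    moreover have "\<bar>\<epsilon> * p\<bar> \<le> \<epsilon> * (K + 1)"
      using p \<open>0 < \<epsilon>\<close> by (simp add: abs_mult)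
    ultimately show "\<bar>\<epsilon> * p\<bar> \<le> min d1 (min d2 d3)" by linarith
  qed
  have lip: "\<bar>?N \<epsilon> p q - ?N \<epsilon> p' q'\<bar> \<le> 2 * \<eta> * (\<bar>p - p'\<bar> + \<bar>q - q'\<bar>)"
    if \<epsilon>: "0 < \<epsilon>" "\<epsilon> \<le> \<epsilon>0" and pq: "\<bar>p\<bar> \<le> K" "\<bar>q\<bar> \<le> K" "\<bar>p'\<bar> \<le> K" "\<bar>q'\<bar> \<le> K" for \<epsilon> p q p' q'
  proof -
    note s = small[OF \<epsilon>]
    define x y x' y' where xy: "x = x0 + \<epsilon> * p" "y = y0 + \<epsilon> * q" "x' = x0 + \<epsilon> * p'" "y' = y0 + \<epsilon> * q'"
    define D where "D = \<bar>p - p'\<bar> + \<bar>q - q'\<bar>"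
    have D: "D \<ge> 0" "\<bar>x - x'\<bar> + \<bar>y - y'\<bar> = \<epsilon> * D"
      using s(1) by (simp_all add: xy D_def abs_mult distrib_left flip: right_diff_distrib)
    have n: "\<bar>x - x0\<bar> \<le> d" "\<bar>y - y0\<bar> \<le> d" "\<bar>x' - x0\<bar> \<le> d" "\<bar>y' - y0\<bar> \<le> d"
      if "d \<in> {d1, d2, d3}" for d
      using that s(4)[OF pq(1)] s(4)[OF pq(2)] s(4)[OF pq(3)] s(4)[OF pq(4)] by (auto simp: xy)
    have G: "\<bar>g x y - g x' y' - (a * (x - x') + b * (y - y'))\<bar> \<le> \<eta> * (\<epsilon> * D)"
      using d1(2)[OF n] D by auto
    have H3: "\<bar>h3 x y - h3 x' y'\<bar> \<le> (\<bar>a3\<bar> + \<bar>b3\<bar> + 1) * (\<epsilon> * D)"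
      using d2(2)[OF n] D by auto
    have H2: "\<bar>h2 x y - h2 x' y'\<bar> \<le> (\<bar>a2\<bar> + \<bar>b2\<bar> + 1) * (\<epsilon> * D)"
      using d3(2)[OF n] D by auto
    have "?N \<epsilon> p q - ?N \<epsilon> p' q' = (g x y - g x' y' - (a * (x - x') + b * (y - y'))) / \<epsilon>
        + \<epsilon>^3 * (h3 x y - h3 x' y') + \<epsilon>^7 * (h2 x y - h2 x' y')"
      unfolding remainder_def xy[symmetric] using s(1)
      by (simp add: xy(1-4) field_simps eval_nat_numeral)
    also have "\<bar>\<dots>\<bar> \<le> \<bar>g x y - g x' y' - (a * (x - x') + b * (y - y'))\<bar> / \<epsilon>
        + \<epsilon>^3 * \<bar>h3 x y - h3 x' y'\<bar> + \<epsilon>^7 * \<bar>h2 x y - h2 x' y'\<bar>"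
      using s(1) by (intro order_trans[OF abs_triangle_ineq] add_mono) (auto simp: abs_mult)
    also have "\<dots> \<le> \<eta> * (\<epsilon> * D) / \<epsilon> + 1 * ((\<bar>a3\<bar> + \<bar>b3\<bar> + 1) * (\<epsilon> * D)) + 1 * ((\<bar>a2\<bar> + \<bar>b2\<bar> + 1) * (\<epsilon> * D))"
      using s(1,2) G H3 H2 by (intro add_mono mult_mono divide_right_mono power_le_one) auto
    also have "\<dots> \<le> \<eta> * D + L * (\<epsilon> * D)"
      using s(1) D(1) by (simp add: L_def algebra_simps)
    also have "L * (\<epsilon> * D) = (\<epsilon> * L) * D" by simp
    also have "\<dots> \<le> \<eta> * D" by (intro mult_right_mono s(3) D)
    finally show ?thesis by (simp add: D_def)
  qed
  have K1: "2 * \<eta> \<le> 2 * \<eta> * (1 + 2 * K)" using K \<eta> by simp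
  show thesis
  proof (rule that)
    show "\<epsilon>0 > 0" using d1 d2 d3 \<eta> L K by (simp add: \<epsilon>0_def)
    show "\<bar>?N \<epsilon> p q - ?N \<epsilon> p' q'\<bar> \<le> e * (\<bar>p - p'\<bar> + \<bar>q - q'\<bar>)"
      if "0 < \<epsilon>" "\<epsilon> \<le> \<epsilon>0" "\<bar>p\<bar> \<le> K" "\<bar>q\<bar> \<le> K" "\<bar>p'\<bar> \<le> K" "\<bar>q'\<bar> \<le> K" for \<epsilon> p q p' q'
      using K1 \<eta>' e by (intro order_trans[OF lip[OF that]] mult_right_mono) auto
    show "\<bar>?N \<epsilon> p q\<bar> \<le> e" if "0 < \<epsilon>" "\<epsilon> \<le> \<epsilon>0" "\<bar>p\<bar> \<le> K" "\<bar>q\<bar> \<le> K" for \<epsilon> p q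
    proof -
      note s = small[OF that(1,2)]
      have "?N \<epsilon> 0 0 = \<epsilon> * (\<epsilon>^2 * h3 x0 y0 + \<epsilon>^6 * h2 x0 y0)"
        using s(1) g(2) by (simp add: remainder_def field_simps eval_nat_numeral)
      also have "\<bar>\<dots>\<bar> \<le> \<epsilon> * (\<epsilon>^2 * \<bar>h3 x0 y0\<bar> + \<epsilon>^6 * \<bar>h2 x0 y0\<bar>)"
        using s(1) by (auto simp: abs_mult intro!: mult_left_mono order_trans[OF abs_triangle_ineq])
      also have "\<dots> \<le> \<epsilon> * (1 * \<bar>h3 x0 y0\<bar> + 1 * \<bar>h2 x0 y0\<bar>)"
        using s(1,2) by (intro mult_left_mono add_mono mult_right_mono power_le_one) auto
      also have "\<dots> \<le> \<epsilon> * L" using s(1) by (intro mult_left_mono) (auto simp: L_def)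
      also have "\<dots> \<le> \<eta>" by (rule s(3))
      finally have N0: "\<bar>?N \<epsilon> 0 0\<bar> \<le> \<eta>" .
      have "\<bar>?N \<epsilon> p q - ?N \<epsilon> 0 0\<bar> \<le> 2 * \<eta> * (\<bar>p\<bar> + \<bar>q\<bar>)"
        using lip[OF that, of 0 0] K by simp
      also have "\<dots> \<le> 2 * \<eta> * (2 * K)"
        using that \<eta> by (intro mult_left_mono) auto
      finally have "\<bar>?N \<epsilon> p q\<bar> \<le> \<eta> + 2 * \<eta> * (2 * K)" using N0 by linarith
      also have "\<dots> \<le> e" using \<eta>' e \<eta> by (simp add: algebra_simps)
      finally show ?thesis .
    qed
  qed
qed

text \<open>
  The components of all forces of the problem have this form. The field is homogeneous of degree
  \<open>-j\<close>, which \<open>hom_field_scale\<close> expresses.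
\<close>

definition hom_field :: "real \<Rightarrow> real \<Rightarrow> real \<Rightarrow> nat \<Rightarrow> real \<Rightarrow> real \<Rightarrow> real" where
  "hom_field b c d j x y = b / x^j + (c * x + d * y) / rad x y ^ (j + 1)"

definition hom_field_dx :: "real \<Rightarrow> real \<Rightarrow> real \<Rightarrow> nat \<Rightarrow> real \<Rightarrow> real \<Rightarrow> real" where
  "hom_field_dx b c d j x y = - real j * b / x^(j + 1) + c / rad x y ^ (j + 1)
     - real (j + 1) * (c * x + d * y) * x / rad x y ^ (j + 3)"

definition hom_field_dy :: "real \<Rightarrow> real \<Rightarrow> real \<Rightarrow> nat \<Rightarrow> real \<Rightarrow> real \<Rightarrow> real" where
  "hom_field_dy b c d j x y = d / rad x y ^ (j + 1)
     - 4 * real (j + 1) * (c * x + d * y) * y / rad x y ^ (j + 3)"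

lemma hom_field_scale:
  assumes "k > 0" "x > 0"
  shows "hom_field b c d j (k * x) (k * y) = hom_field b c d j x y / k^j"
proof -
  have "(c * (k * x) + d * (k * y)) = k * (c * x + d * y)" by (simp add: algebra_simps)
  moreover have "k * X / (k * D) ^ (j + 1) = X / D ^ (j + 1) / k ^ j" for X D
    using assms by (simp add: power_mult_distrib)
  ultimately show ?thesis
    using assms by (simp add: hom_field_def rad_scale power_mult_distrib add_divide_distrib mult_ac)
qed

lemma continuous_on_rad [continuous_intros]:
  assumes "continuous_on S f" "continuous_on S h"
  shows "continuous_on S (\<lambda>x. rad (f x) (h x))"
  unfolding rad_def using assms by (intro continuous_intros)

lemma continuous_on_hom_field [continuous_intros]:
  assumes "continuous_on S f" "continuous_on S h" "\<And>x. x \<in> S \<Longrightarrow> f x > 0"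
  shows "continuous_on S (\<lambda>x. hom_field b c d j (f x) (h x))"
  unfolding hom_field_def using assms rad_pos
  by (intro continuous_intros) (auto simp: less_imp_neq[symmetric] dest!: assms(3) rad_pos)

lemma hom_field_strictly_differentiable:
  assumes "x0 > 0"
  shows "strictly_differentiable (hom_field b c d j) x0 y0
    (hom_field_dx b c d j x0 y0) (hom_field_dy b c d j x0 y0)"
proof (rule strictly_differentiable_partials[OF assms])
  fix x y :: real assume x: "x > 0"
  note n [simp] = less_imp_neq[OF x, symmetric] less_imp_neq[OF rad_pos[OF x, of y], symmetric]
  have A: "((\<lambda>x. b / x^j) has_real_derivative - real j * b / x^(j + 1)) (at x)"
  proof (cases j)
    case (Suc n)
    show ?thesis
      by (rule DERIV_cong[OF DERIV_divide[OF DERIV_const DERIV_pow]])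
        (simp_all add: Suc field_simps)
  qed simp
  have P: "((\<lambda>x. rad x y ^ (j + 1)) has_real_derivative
      real (j + 1) * rad x y ^ j * (x / rad x y)) (at x)"
    by (rule DERIV_cong[OF DERIV_power[OF rad_deriv_R[OF x]]]) simp
  have "((\<lambda>x. (c * x + d * y) / rad x y ^ (j + 1)) has_real_derivative
      (c * rad x y ^ (j + 1) - (c * x + d * y) * (real (j + 1) * rad x y ^ j * (x / rad x y)))
        / (rad x y ^ (j + 1) * rad x y ^ (j + 1))) (at x)"
    by (rule DERIV_cong[OF DERIV_divide[OF _ P, of "\<lambda>x. c * x + d * y" c]])
      (auto intro!: derivative_eq_intros)
  also have "(c * rad x y ^ (j + 1) - (c * x + d * y) * (real (j + 1) * rad x y ^ j * (x / rad x y)))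
        / (rad x y ^ (j + 1) * rad x y ^ (j + 1)) =
      c / rad x y ^ (j + 1) - real (j + 1) * (c * x + d * y) * x / rad x y ^ (j + 3)"
    by (simp add: field_simps power3_eq_cube power_add)
  finally show "((\<lambda>x. hom_field b c d j x y) has_real_derivative hom_field_dx b c d j x y) (at x)"
    unfolding hom_field_def hom_field_dx_def
    by (intro DERIV_cong[OF DERIV_add[OF A]]) auto
  have P: "((\<lambda>y. rad x y ^ (j + 1)) has_real_derivative
      real (j + 1) * rad x y ^ j * (4 * y / rad x y)) (at y)"
    by (rule DERIV_cong[OF DERIV_power[OF rad_deriv_z[OF x]]]) simp
  have "((\<lambda>y. (c * x + d * y) / rad x y ^ (j + 1)) has_real_derivative
      (d * rad x y ^ (j + 1) - (c * x + d * y) * (real (j + 1) * rad x y ^ j * (4 * y / rad x y)))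
        / (rad x y ^ (j + 1) * rad x y ^ (j + 1))) (at y)"
    by (rule DERIV_cong[OF DERIV_divide[OF _ P, of "\<lambda>y. c * x + d * y" d]])
      (auto intro!: derivative_eq_intros)
  also have "(d * rad x y ^ (j + 1) - (c * x + d * y) * (real (j + 1) * rad x y ^ j * (4 * y / rad x y)))
        / (rad x y ^ (j + 1) * rad x y ^ (j + 1)) = hom_field_dy b c d j x y"
    by (simp add: hom_field_dy_def field_simps power3_eq_cube power_add)
  finally show "((\<lambda>y. hom_field b c d j x y) has_real_derivative hom_field_dy b c d j x y) (at y)"
    unfolding hom_field_def by (intro DERIV_cong[OF DERIV_add[OF DERIV_const]]) auto
next
  have n: "fst p \<noteq> 0" "rad (fst p) (snd p) \<noteq> 0" if "p \<in> {0<..} \<times> (UNIV :: real set)" for p :: "real \<times> real"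
    using that rad_pos[of "fst p" "snd p"] by auto
  show "continuous_on ({0<..} \<times> UNIV) (\<lambda>p. hom_field_dx b c d j (fst p) (snd p))"
    unfolding hom_field_dx_def by (intro continuous_intros ballI) (use n in auto)
  show "continuous_on ({0<..} \<times> UNIV) (\<lambda>p. hom_field_dy b c d j (fst p) (snd p))"
    unfolding hom_field_dy_def by (intro continuous_intros ballI) (use n in auto)
qed

section \<open>Collision along a hyperbolic ray\<close>

text \<open>
  The change of variables for one coordinate, with \<open>t = - exp (- s)\<close> and collision at \<open>t = 0\<close>. The
  constants come from \<open>x0 \<tau>\<^bsup>2/5\<^esup>\<close>, whose second derivative is \<open>- 6/25 x0 \<tau>\<^bsup>- 8/5\<^esup>\<close>, and from
  \<open>1/100 - 1/4 = - 6/25\<close>: the second derivative of \<open>\<tau>\<^bsup>1/2\<^esup> p\<close> is \<open>\<tau>\<^bsup>- 3/2\<^esup> (p'' - p / 4)\<close>.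
\<close>

lemma rescaled_equation:
  fixes p p' Q :: "real \<Rightarrow> real" and x0 S t :: real
  defines "X \<equiv> \<lambda>t. exp (- (2/5) * (- ln (- t))) * x0 + exp (- (1/2) * (- ln (- t))) * p (- ln (- t))"
    and "V \<equiv> \<lambda>t. - (2/5) * x0 * exp (3/5 * (- ln (- t)))
       + exp (1/2 * (- ln (- t))) * (p' (- ln (- t)) - p (- ln (- t)) / 2)"
  assumes p: "\<And>s. (p has_real_derivative p' s) (at s)"
    and p': "\<And>s. s \<ge> S \<Longrightarrow> (p' has_real_derivative p s / 100 + exp (1/10 * s) * Q s) (at s)"
    and t: "- exp (- S) < t" "t < 0"
  shows "(X has_real_derivative V t) (at t)"
    and "(V has_real_derivative exp (8/5 * (- ln (- t))) *
      (Q (- ln (- t)) - 6/25 * (x0 + exp (- (1/10) * (- ln (- t))) * p (- ln (- t))))) (at t)"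
proof -
  define s where "s = - ln (- t)"
  have s: "s \<ge> S"
    using t ln_less_cancel_iff[of "- t" "exp (- S)"] by (simp add: s_def)
  have ds: "((\<lambda>t. - ln (- t)) has_real_derivative exp s) (at t)"
  proof -
    have "exp s = inverse (- t)" using t by (simp add: s_def exp_minus)
    then show ?thesis using t by (auto intro!: derivative_eq_intros simp: field_simps)
  qed
  have e: "exp (1/2 * s) = exp s * exp (- (1/2) * s)" "exp (3/5 * s) = exp s * exp (- (2/5) * s)"
    "exp (8/5 * s) = exp s * exp (3/5 * s)" "exp (1/10 * s) * exp (1/2 * s) = exp (3/5 * s)"
    "exp (3/5 * s) * exp (- (1/10) * s) = exp (1/2 * s)"
    by (simp_all flip: exp_add)
  have "((\<lambda>s. exp (- (2/5) * s) * x0 + exp (- (1/2) * s) * p s) has_real_derivative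
      - (2/5) * exp (- (2/5) * s) * x0 + exp (- (1/2) * s) * (p' s - p s / 2)) (at s)"
    by (auto intro!: derivative_eq_intros p simp: algebra_simps)
  from DERIV_chain2[OF this[unfolded s_def] ds]
  show "(X has_real_derivative V t) (at t)"
    unfolding X_def V_def s_def[symmetric] e by (rule DERIV_cong) (simp add: algebra_simps)
  have "((\<lambda>s. - (2/5) * x0 * exp (3/5 * s) + exp (1/2 * s) * (p' s - p s / 2)) has_real_derivative
      - (6/25) * x0 * exp (3/5 * s) + exp (1/2 * s) * (1/2 * (p' s - p s / 2)
        + (p s / 100 + exp (1/10 * s) * Q s - p' s / 2))) (at s)"
    by (auto intro!: derivative_eq_intros p p'[OF s] simp: algebra_simps)
  also have "- (6/25) * x0 * exp (3/5 * s) + exp (1/2 * s) * (1/2 * (p' s - p s / 2)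
        + (p s / 100 + exp (1/10 * s) * Q s - p' s / 2)) =
      - (6/25) * x0 * exp (3/5 * s) - 6/25 * exp (1/2 * s) * p s + (exp (1/10 * s) * exp (1/2 * s)) * Q s"
    by (simp add: algebra_simps)
  also have "\<dots> = exp (3/5 * s) * (Q s - 6/25 * x0) - 6/25 * (exp (3/5 * s) * exp (- (1/10) * s)) * p s"
    unfolding e(4,5) by (simp add: algebra_simps)
  also have "\<dots> = exp (3/5 * s) * (Q s - 6/25 * (x0 + exp (- (1/10) * s) * p s))"
    by (simp add: algebra_simps)
  finally have "((\<lambda>s. - (2/5) * x0 * exp (3/5 * s) + exp (1/2 * s) * (p' s - p s / 2)) has_real_derivative
      exp (3/5 * s) * (Q s - 6/25 * (x0 + exp (- (1/10) * s) * p s))) (at s)" .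
  from DERIV_chain2[OF this[unfolded s_def] ds]
  show "(V has_real_derivative exp (8/5 * (- ln (- t))) *
      (Q (- ln (- t)) - 6/25 * (x0 + exp (- (1/10) * (- ln (- t))) * p (- ln (- t))))) (at t)"
    unfolding V_def s_def[symmetric] e(3) by (rule DERIV_cong) (simp add: algebra_simps)
qed

lemma log_time_at_top: "filterlim (\<lambda>t::real. - ln (- t)) at_top (at_left 0)"
  using ln_at_0 by (simp add: at_left_minus filterlim_filtermap filterlim_uminus_at_top)

text \<open>
  The assumptions \<open>central\<close> say that \<open>\<tau>\<^bsup>2/5\<^esup> (x0, y0)\<close> is a solution for the fields of degree \<open>-4\<close>
  alone. The matrix \<open>(a11, a12; a21, a22)\<close> is the Jacobian of these fields shifted by \<open>6/25\<close>, with
  eigenvectors \<open>(1, l)\<close> and \<open>(- \<gamma>, 1)\<close>; nonnegative eigenvalues suffice because of the additional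
  \<open>1/100\<close> in the rescaled equation. The coordinates \<open>u, v\<close> of the proof refer to these eigenvectors, in
  which the linear part is diagonal.
\<close>

lemma collision_along_hyperbolic_ray:
  fixes b c d b' c' d' :: "nat \<Rightarrow> real" and x0 y0 l \<gamma> ev1 ev2 :: real
  defines "f \<equiv> \<lambda>j. hom_field (b j) (c j) (d j) j"
    and "h \<equiv> \<lambda>j. hom_field (b' j) (c' j) (d' j) j"
    and "a11 \<equiv> 6/25 + hom_field_dx (b 4) (c 4) (d 4) 4 x0 y0"
    and "a12 \<equiv> hom_field_dy (b 4) (c 4) (d 4) 4 x0 y0"
    and "a21 \<equiv> hom_field_dx (b' 4) (c' 4) (d' 4) 4 x0 y0"
    and "a22 \<equiv> 6/25 + hom_field_dy (b' 4) (c' 4) (d' 4) 4 x0 y0"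
  assumes x0: "x0 > 0"
    and central: "6/25 * x0 + f 4 x0 y0 = 0" "6/25 * y0 + h 4 x0 y0 = 0"
    and eig1: "a11 + a12 * l = ev1" "a21 + a22 * l = ev1 * l"
    and eig2: "- \<gamma> * a11 + a12 = - \<gamma> * ev2" "- \<gamma> * a21 + a22 = ev2"
    and pos: "ev1 \<ge> 0" "ev2 \<ge> 0" "\<gamma> * l \<ge> 0"
  obtains T X Z V W where "T > 0"
    "\<And>t. - T < t \<Longrightarrow> t < 0 \<Longrightarrow> X t > 0"
    "\<And>t. - T < t \<Longrightarrow> t < 0 \<Longrightarrow> (X has_real_derivative V t) (at t)"
    "\<And>t. - T < t \<Longrightarrow> t < 0 \<Longrightarrow> (Z has_real_derivative W t) (at t)"
    "\<And>t. - T < t \<Longrightarrow> t < 0 \<Longrightarrow>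
       (V has_real_derivative f 4 (X t) (Z t) + f 3 (X t) (Z t) + f 2 (X t) (Z t)) (at t)"
    "\<And>t. - T < t \<Longrightarrow> t < 0 \<Longrightarrow>
       (W has_real_derivative h 4 (X t) (Z t) + h 3 (X t) (Z t) + h 2 (X t) (Z t)) (at t)"
    "(X \<longlongrightarrow> 0) (at_left 0)" "(Z \<longlongrightarrow> 0) (at_left 0)"
    "((\<lambda>t. Z t / X t) \<longlongrightarrow> y0 / x0) (at_left 0)"
proof -
  define gx where "gx = (\<lambda>x y. 6/25 * x + 0 * y + f 4 x y)"
  define gy where "gy = (\<lambda>x y. 0 * x + 6/25 * y + h 4 x y)"
  define K where "K = 1 + \<bar>l\<bar> + \<bar>\<gamma>\<bar>"
  define \<Delta> where "\<Delta> = 1 + \<gamma> * l"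
  define k1 k2 where "k1 = sqrt (1/100 + ev1)" and "k2 = sqrt (1/100 + ev2)"
  have k: "k1 > 0" "k2 > 0" "k1\<^sup>2 = 1/100 + ev1" "k2\<^sup>2 = 1/100 + ev2"
    using pos by (simp_all add: k1_def k2_def)
  define C where "C = 1 / (2 * (1 / k1\<^sup>2 + 1 / k2\<^sup>2))"
  have "1 / k1\<^sup>2 + 1 / k2\<^sup>2 > 0" using k(1,2) by (intro add_pos_pos) auto
  then have C: "C > 0" "C * (1 / k1\<^sup>2 + 1 / k2\<^sup>2) \<le> 1/2"
    by (simp_all add: C_def)
  have K: "K \<ge> 1" and K0: "K \<ge> 0" by (simp_all add: K_def)
  have \<Delta>: "\<Delta> \<ge> 1" using pos by (simp add: \<Delta>_def)
  define e where "e = C / (2 * K * K)"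
  have e: "e > 0" "2 * K * K * e = C" using C K by (simp_all add: e_def)
  have gx: "strictly_differentiable gx x0 y0 a11 a12" "gx x0 y0 = 0"
    using strictly_differentiable_add_linear[OF hom_field_strictly_differentiable[OF x0],
        of "6/25" 0 "b 4" "c 4" "d 4" 4 y0] central
    by (simp_all add: gx_def f_def a11_def a12_def)
  have gy: "strictly_differentiable gy x0 y0 a21 a22" "gy x0 y0 = 0"
    using strictly_differentiable_add_linear[OF hom_field_strictly_differentiable[OF x0],
        of 0 "6/25" "b' 4" "c' 4" "d' 4" 4 y0] central
    by (simp_all add: gy_def h_def a21_def a22_def)
  define Nx where "Nx = remainder gx (f 3) (f 2) x0 y0 a11 a12"
  define Ny where "Ny = remainder gy (h 3) (h 2) x0 y0 a21 a22"
  obtain \<epsilon>x where \<epsilon>x: "\<epsilon>x > 0"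
    "\<And>\<epsilon> p q. 0 < \<epsilon> \<Longrightarrow> \<epsilon> \<le> \<epsilon>x \<Longrightarrow> \<bar>p\<bar> \<le> K \<Longrightarrow> \<bar>q\<bar> \<le> K \<Longrightarrow> \<bar>Nx \<epsilon> p q\<bar> \<le> e"
    "\<And>\<epsilon> p q p' q'. 0 < \<epsilon> \<Longrightarrow> \<epsilon> \<le> \<epsilon>x \<Longrightarrow> \<bar>p\<bar> \<le> K \<Longrightarrow> \<bar>q\<bar> \<le> K \<Longrightarrow> \<bar>p'\<bar> \<le> K \<Longrightarrow> \<bar>q'\<bar> \<le> K \<Longrightarrow>
       \<bar>Nx \<epsilon> p q - Nx \<epsilon> p' q'\<bar> \<le> e * (\<bar>p - p'\<bar> + \<bar>q - q'\<bar>)"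
    using remainder_small[OF gx hom_field_strictly_differentiable[OF x0, of "b 3"]
        hom_field_strictly_differentiable[OF x0, of "b 2"] e(1) K0]
    unfolding Nx_def f_def by blast
  obtain \<epsilon>y where \<epsilon>y: "\<epsilon>y > 0"
    "\<And>\<epsilon> p q. 0 < \<epsilon> \<Longrightarrow> \<epsilon> \<le> \<epsilon>y \<Longrightarrow> \<bar>p\<bar> \<le> K \<Longrightarrow> \<bar>q\<bar> \<le> K \<Longrightarrow> \<bar>Ny \<epsilon> p q\<bar> \<le> e"
    "\<And>\<epsilon> p q p' q'. 0 < \<epsilon> \<Longrightarrow> \<epsilon> \<le> \<epsilon>y \<Longrightarrow> \<bar>p\<bar> \<le> K \<Longrightarrow> \<bar>q\<bar> \<le> K \<Longrightarrow> \<bar>p'\<bar> \<le> K \<Longrightarrow> \<bar>q'\<bar> \<le> K \<Longrightarrow>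
       \<bar>Ny \<epsilon> p q - Ny \<epsilon> p' q'\<bar> \<le> e * (\<bar>p - p'\<bar> + \<bar>q - q'\<bar>)"
    using remainder_small[OF gy hom_field_strictly_differentiable[OF x0, of "b' 3"]
        hom_field_strictly_differentiable[OF x0, of "b' 2"] e(1) K0]
    unfolding Ny_def h_def by blast
  \<comment> \<open>the first bound keeps the first coordinate positive, where the fields are smooth\<close>
  define \<epsilon>0 where "\<epsilon>0 = min (x0 / (2 * K)) (min \<epsilon>x \<epsilon>y)"
  have \<epsilon>0: "\<epsilon>0 > 0" using \<epsilon>x(1) \<epsilon>y(1) x0 K by (simp add: \<epsilon>0_def)
  define S where "S = - 10 * ln \<epsilon>0"
  define E where "E s = exp (- (1/10) * s)" for s :: real
  have E: "0 < E s" for s by (simp add: E_def)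
  have ES: "E s \<le> \<epsilon>x" "E s \<le> \<epsilon>y" "E s * K \<le> x0 / 2" if "s \<ge> S" for s
  proof -
    have "- (1/10) * s \<le> ln \<epsilon>0" using that by (simp add: S_def)
    then have "E s \<le> \<epsilon>0" using \<epsilon>0 by (metis E_def exp_le_cancel_iff exp_ln)
    then have le: "E s \<le> \<epsilon>x" "E s \<le> \<epsilon>y" "E s \<le> x0 / (2 * K)" by (simp_all add: \<epsilon>0_def)
    then show "E s \<le> \<epsilon>x" "E s \<le> \<epsilon>y" by simp_all
    show "E s * K \<le> x0 / 2" using le(3) K by (simp add: field_simps)
  qed
  \<comment> \<open>the original coordinates \<open>(p, q) = u (1, l) + v (- \<gamma>, 1)\<close>, of which \<open>\<Delta>\<close> is the determinant\<close>
  define P where "P w = fst w - \<gamma> * snd w" for w :: "real \<times> real"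
  define R where "R w = l * fst w + snd w" for w :: "real \<times> real"
  have comp: "\<bar>fst w\<bar> \<le> norm w" "\<bar>snd w\<bar> \<le> norm w" for w :: "real \<times> real"
    using norm_fst_le[of "fst w" "snd w"] norm_snd_le[of "snd w" "fst w"] by simp_all
  have PR: "\<bar>P w\<bar> \<le> K * norm w" "\<bar>R w\<bar> \<le> K * norm w" for w
  proof -
    have "\<bar>P w\<bar> \<le> \<bar>fst w\<bar> + \<bar>\<gamma>\<bar> * \<bar>snd w\<bar>" "\<bar>R w\<bar> \<le> \<bar>l\<bar> * \<bar>fst w\<bar> + \<bar>snd w\<bar>"
      unfolding P_def R_def by (metis abs_mult abs_triangle_ineq4) (metis abs_mult abs_triangle_ineq)
    moreover have "\<bar>fst w\<bar> + \<bar>\<gamma>\<bar> * \<bar>snd w\<bar> \<le> 1 * norm w + \<bar>\<gamma>\<bar> * norm w"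
      "\<bar>l\<bar> * \<bar>fst w\<bar> + \<bar>snd w\<bar> \<le> \<bar>l\<bar> * norm w + 1 * norm w"
      using comp[of w] by (intro add_mono mult_left_mono; simp)+
    moreover have "1 * norm w + \<bar>\<gamma>\<bar> * norm w \<le> K * norm w" "\<bar>l\<bar> * norm w + 1 * norm w \<le> K * norm w"
      by (simp_all add: K_def algebra_simps)
    ultimately show "\<bar>P w\<bar> \<le> K * norm w" "\<bar>R w\<bar> \<le> K * norm w" by linarith+
  qed
  have PR1: "\<bar>P w\<bar> \<le> K" "\<bar>R w\<bar> \<le> K" if "norm w \<le> 1" for w
    using PR[of w] mult_left_mono[OF that K0] by linarith+
  have PRd: "\<bar>P w - P w'\<bar> + \<bar>R w - R w'\<bar> \<le> 2 * K * dist w w'" for w w'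
  proof -
    have "P w - P w' = P (w - w')" "R w - R w' = R (w - w')"
      by (simp_all add: P_def R_def algebra_simps)
    then show ?thesis using PR[of "w - w'"] by (simp add: dist_norm)
  qed
  define N1 where "N1 s w = (Nx (E s) (P w) (R w) + \<gamma> * Ny (E s) (P w) (R w)) / \<Delta>" for s w
  define N2 where "N2 s w = (Ny (E s) (P w) (R w) - l * Nx (E s) (P w) (R w)) / \<Delta>" for s w
  have mix: "\<bar>(x + \<gamma> * y) / \<Delta>\<bar> \<le> K * D" "\<bar>(y - l * x) / \<Delta>\<bar> \<le> K * D"
    if "\<bar>x\<bar> \<le> D" "\<bar>y\<bar> \<le> D" for x y D
  proof -
    have D: "D \<ge> 0" using that by linarith
    have "\<bar>x + \<gamma> * y\<bar> \<le> \<bar>x\<bar> + \<bar>\<gamma>\<bar> * \<bar>y\<bar>" "\<bar>y - l * x\<bar> \<le> \<bar>y\<bar> + \<bar>l\<bar> * \<bar>x\<bar>"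
      by (metis abs_mult abs_triangle_ineq) (metis abs_mult abs_triangle_ineq4)
    moreover have "\<bar>x\<bar> + \<bar>\<gamma>\<bar> * \<bar>y\<bar> \<le> D + \<bar>\<gamma>\<bar> * D" "\<bar>y\<bar> + \<bar>l\<bar> * \<bar>x\<bar> \<le> D + \<bar>l\<bar> * D"
      using that by (intro add_mono mult_left_mono; simp)+
    moreover have "D + \<bar>\<gamma>\<bar> * D \<le> K * D" "D + \<bar>l\<bar> * D \<le> K * D"
      using D by (simp_all add: K_def algebra_simps)
    ultimately have 1: "\<bar>x + \<gamma> * y\<bar> \<le> K * D" "\<bar>y - l * x\<bar> \<le> K * D" by linarith+
    have "\<bar>a / \<Delta>\<bar> \<le> \<bar>a\<bar>" for a
      using \<Delta> by (simp add: abs_divide divide_le_eq mult_left_mono[of 1 \<Delta> "\<bar>a\<bar>", simplified])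
    then show "\<bar>(x + \<gamma> * y) / \<Delta>\<bar> \<le> K * D" "\<bar>(y - l * x) / \<Delta>\<bar> \<le> K * D"
      using 1 order_trans by blast+
  qed
  have Ke: "K * e \<le> C"
  proof -
    have "K * e * 1 \<le> K * e * (2 * K)" using K e by (intro mult_left_mono) auto
    then show ?thesis using e(2) by (simp add: mult_ac)
  qed
  have bnd: "\<bar>N1 s w\<bar> \<le> C" "\<bar>N2 s w\<bar> \<le> C" if "s \<ge> S" "norm w \<le> 1" for s w
    using mix[OF \<epsilon>x(2)[OF E ES(1)[OF that(1)] PR1[OF that(2)]] \<epsilon>y(2)[OF E ES(2)[OF that(1)] PR1[OF that(2)]]] Ke
    unfolding N1_def N2_def by linarith+
  have lip: "\<bar>N1 s w - N1 s w'\<bar> \<le> C * dist w w'" "\<bar>N2 s w - N2 s w'\<bar> \<le> C * dist w w'"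
    if "s \<ge> S" "norm w \<le> 1" "norm w' \<le> 1" for s w w'
  proof -
    have d: "e * (\<bar>P w - P w'\<bar> + \<bar>R w - R w'\<bar>) \<le> e * (2 * K * dist w w')"
      using e PRd by (intro mult_left_mono) auto
    have 1: "\<bar>Nx (E s) (P w) (R w) - Nx (E s) (P w') (R w')\<bar> \<le> e * (2 * K * dist w w')"
      using \<epsilon>x(3)[OF E ES(1)[OF that(1)] PR1[OF that(2)] PR1[OF that(3)]] d by linarith
    have 2: "\<bar>Ny (E s) (P w) (R w) - Ny (E s) (P w') (R w')\<bar> \<le> e * (2 * K * dist w w')"
      using \<epsilon>y(3)[OF E ES(2)[OF that(1)] PR1[OF that(2)] PR1[OF that(3)]] d by linarith
    have N: "N1 s w - N1 s w' = ((Nx (E s) (P w) (R w) - Nx (E s) (P w') (R w'))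
        + \<gamma> * (Ny (E s) (P w) (R w) - Ny (E s) (P w') (R w'))) / \<Delta>"
      "N2 s w - N2 s w' = ((Ny (E s) (P w) (R w) - Ny (E s) (P w') (R w'))
        - l * (Nx (E s) (P w) (R w) - Nx (E s) (P w') (R w'))) / \<Delta>"
      by (simp_all add: N1_def N2_def diff_divide_distrib add_divide_distrib right_diff_distrib)
    have KC: "K * (e * (2 * K * dist w w')) = C * dist w w'"
      using e(2) by (metis mult.assoc mult.commute)
    show "\<bar>N1 s w - N1 s w'\<bar> \<le> C * dist w w'" "\<bar>N2 s w - N2 s w'\<bar> \<le> C * dist w w'"
      unfolding N KC[symmetric] by (rule mix[OF 1 2])+
  qed
  have Xpos: "x0 + E s * p > 0" if "s \<ge> S" "\<bar>p\<bar> \<le> K" for s p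
  proof -
    have "E s * \<bar>p\<bar> \<le> E s * K" using that E[of s] by (intro mult_left_mono) auto
    moreover have "\<bar>E s * p\<bar> = E s * \<bar>p\<bar>" using E[of s] by (simp add: abs_mult)
    ultimately show ?thesis using ES(3)[OF that(1)] x0 by linarith
  qed
  have contN: "continuous_on ({S..} \<times> cball 0 1) (\<lambda>x. Nx (E (fst x)) (P (snd x)) (R (snd x)))"
    "continuous_on ({S..} \<times> cball 0 1) (\<lambda>x. Ny (E (fst x)) (P (snd x)) (R (snd x)))"
    unfolding Nx_def Ny_def remainder_def gx_def gy_def f_def h_def
    using Xpos PR1 E unfolding E_def P_def R_def
    by (auto intro!: continuous_intros simp: mem_cball_0)
  have cont: "continuous_on ({S..} \<times> cball 0 1) (\<lambda>(s, x). N1 s x)"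
    "continuous_on ({S..} \<times> cball 0 1) (\<lambda>(s, x). N2 s x)"
    using \<Delta> unfolding N1_def N2_def case_prod_beta
    by (intro continuous_intros contN; simp)+
  obtain u v u' v' where uv: "\<And>s. norm (u s, v s) \<le> 1"
    "\<And>s. (u has_real_derivative u' s) (at s)" "\<And>s. (v has_real_derivative v' s) (at s)"
    "\<And>s. s \<ge> S \<Longrightarrow> (u' has_real_derivative k1\<^sup>2 * u s + N1 s (u s, v s)) (at s)"
    "\<And>s. s \<ge> S \<Longrightarrow> (v' has_real_derivative k2\<^sup>2 * v s + N2 s (u s, v s)) (at s)"
    using bounded_solution_exists[OF k(1,2) cont bnd lip C(2)] by blast
  define p q p' q' where "p s = u s - \<gamma> * v s" and "q s = l * u s + v s"
    and "p' s = u' s - \<gamma> * v' s" and "q' s = l * u' s + v' s" for s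
  have pqK: "\<bar>p s\<bar> \<le> K" "\<bar>q s\<bar> \<le> K" for s
    using PR1[OF uv(1)[of s]] by (simp_all add: P_def R_def p_def q_def)
  define x y where "x s = x0 + E s * p s" and "y s = y0 + E s * q s" for s
  have xpos: "x s > 0" if "s \<ge> S" for s
    using Xpos[OF that pqK(1)] by (simp add: x_def)
  define Qx Qy where "Qx s = gx (x s) (y s) + E s ^ 4 * f 3 (x s) (y s) + E s ^ 8 * f 2 (x s) (y s)"
    and "Qy s = gy (x s) (y s) + E s ^ 4 * h 3 (x s) (y s) + E s ^ 8 * h 2 (x s) (y s)" for s
  have Einv: "a / E s = exp (1/10 * s) * a" for a s
    by (simp add: E_def exp_minus field_simps)
  have Nxy: "Nx (E s) (p s) (q s) = exp (1/10 * s) * Qx s - (a11 * p s + a12 * q s)"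
    "Ny (E s) (p s) (q s) = exp (1/10 * s) * Qy s - (a21 * p s + a22 * q s)" for s
    unfolding Nx_def Ny_def remainder_def Qx_def Qy_def x_def y_def Einv by (rule refl)+
  have N12: "N1 s (u s, v s) = (Nx (E s) (p s) (q s) + \<gamma> * Ny (E s) (p s) (q s)) / \<Delta>"
    "N2 s (u s, v s) = (Ny (E s) (p s) (q s) - l * Nx (E s) (p s) (q s)) / \<Delta>" for s
    by (simp_all add: N1_def N2_def P_def R_def p_def q_def)
  have inv: "(n + \<gamma> * n') / \<Delta> - \<gamma> * ((n' - l * n) / \<Delta>) = n"
    "l * ((n + \<gamma> * n') / \<Delta>) + (n' - l * n) / \<Delta> = n'" for n n'
  proof -
    have "(n + \<gamma> * n') / \<Delta> - \<gamma> * ((n' - l * n) / \<Delta>) = (n * \<Delta>) / \<Delta>"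
      "l * ((n + \<gamma> * n') / \<Delta>) + (n' - l * n) / \<Delta> = (n' * \<Delta>) / \<Delta>"
      by (simp_all add: \<Delta>_def diff_divide_distrib add_divide_distrib algebra_simps)
    then show "(n + \<gamma> * n') / \<Delta> - \<gamma> * ((n' - l * n) / \<Delta>) = n"
      "l * ((n + \<gamma> * n') / \<Delta>) + (n' - l * n) / \<Delta> = n'"
      using \<Delta> by simp_all
  qed
  have lin: "ev1 * U - \<gamma> * (ev2 * W) = a11 * (U - \<gamma> * W) + a12 * (l * U + W)"
    "l * (ev1 * U) + ev2 * W = a21 * (U - \<gamma> * W) + a22 * (l * U + W)" for U W
  proof -
    have "ev1 * U - \<gamma> * (ev2 * W) = ev1 * U + (- \<gamma> * ev2) * W" by simp
    also have "\<dots> = a11 * (U - \<gamma> * W) + a12 * (l * U + W)"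
      unfolding eig2(1)[symmetric] eig1(1)[symmetric] by (simp add: algebra_simps)
    finally show "ev1 * U - \<gamma> * (ev2 * W) = a11 * (U - \<gamma> * W) + a12 * (l * U + W)" .
    have "l * (ev1 * U) + ev2 * W = (ev1 * l) * U + ev2 * W" by simp
    also have "\<dots> = a21 * (U - \<gamma> * W) + a22 * (l * U + W)"
      unfolding eig2(2)[symmetric] eig1(2)[symmetric] by (simp add: algebra_simps)
    finally show "l * (ev1 * U) + ev2 * W = a21 * (U - \<gamma> * W) + a22 * (l * U + W)" .
  qed
  have dp: "(p has_real_derivative p' s) (at s)" "(q has_real_derivative q' s) (at s)" for s
    unfolding p_def[abs_def] q_def[abs_def] p'_def q'_def
    by (auto intro!: derivative_eq_intros uv(2,3))
  have dp': "(p' has_real_derivative p s / 100 + exp (1/10 * s) * Qx s) (at s)" if s: "s \<ge> S" for s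
  proof -
    have "(p' has_real_derivative (k1\<^sup>2 * u s + N1 s (u s, v s)) - \<gamma> * (k2\<^sup>2 * v s + N2 s (u s, v s))) (at s)"
      unfolding p'_def[abs_def] by (intro derivative_intros DERIV_cmult uv(4,5) s)
    also have "(k1\<^sup>2 * u s + N1 s (u s, v s)) - \<gamma> * (k2\<^sup>2 * v s + N2 s (u s, v s)) =
        p s / 100 + (ev1 * u s - \<gamma> * (ev2 * v s)) + (N1 s (u s, v s) - \<gamma> * N2 s (u s, v s))"
      by (simp add: k p_def algebra_simps add_divide_distrib diff_divide_distrib)
    also have "\<dots> = p s / 100 + exp (1/10 * s) * Qx s"
      unfolding N12 inv(1) Nxy lin(1) p_def[symmetric] q_def[symmetric] by simp
    finally show ?thesis .
  qed
  have dq': "(q' has_real_derivative q s / 100 + exp (1/10 * s) * Qy s) (at s)" if s: "s \<ge> S" for s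
  proof -
    have "(q' has_real_derivative l * (k1\<^sup>2 * u s + N1 s (u s, v s)) + (k2\<^sup>2 * v s + N2 s (u s, v s))) (at s)"
      unfolding q'_def[abs_def] by (intro derivative_intros DERIV_cmult uv(4,5) s)
    also have "l * (k1\<^sup>2 * u s + N1 s (u s, v s)) + (k2\<^sup>2 * v s + N2 s (u s, v s)) =
        q s / 100 + (l * (ev1 * u s) + ev2 * v s) + (l * N1 s (u s, v s) + N2 s (u s, v s))"
      by (simp add: k q_def algebra_simps add_divide_distrib diff_divide_distrib)
    also have "\<dots> = q s / 100 + exp (1/10 * s) * Qy s"
      unfolding N12 inv(2) Nxy lin(2) p_def[symmetric] q_def[symmetric] by simp
    finally show ?thesis .
  qed
  define X where "X t = exp (- (2/5) * (- ln (- t))) * x0 + exp (- (1/2) * (- ln (- t))) * p (- ln (- t))" for t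
  define Z where "Z t = exp (- (2/5) * (- ln (- t))) * y0 + exp (- (1/2) * (- ln (- t))) * q (- ln (- t))" for t
  define V where "V t = - (2/5) * x0 * exp (3/5 * (- ln (- t)))
       + exp (1/2 * (- ln (- t))) * (p' (- ln (- t)) - p (- ln (- t)) / 2)" for t
  define W where "W t = - (2/5) * y0 * exp (3/5 * (- ln (- t)))
       + exp (1/2 * (- ln (- t))) * (q' (- ln (- t)) - q (- ln (- t)) / 2)" for t
  have E4: "exp (- (2/5) * s) = E s ^ 4" "exp (- (1/2) * s) = E s ^ 4 * E s" for s
    unfolding E_def by (simp_all flip: exp_of_nat_mult exp_add)
  have XZ: "X t = E (- ln (- t)) ^ 4 * x (- ln (- t))" "Z t = E (- ln (- t)) ^ 4 * y (- ln (- t))" for t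
    unfolding X_def Z_def E4 x_def y_def by (simp_all add: algebra_simps)
  have force: "exp (8/5 * s) * (A + E s ^ 4 * B + E s ^ 8 * D) =
      A / (E s ^ 4) ^ 4 + B / (E s ^ 4) ^ 3 + D / (E s ^ 4) ^ 2" for s A B D
  proof -
    have "exp (8/5 * s) * E s ^ 16 = 1"
      unfolding E_def by (simp flip: exp_of_nat_mult exp_add)
    then have "exp (8/5 * s) = 1 / E s ^ 16"
      using E[of s] by (simp add: field_simps)
    show ?thesis
      unfolding \<open>exp (8/5 * s) = 1 / E s ^ 16\<close> using E[of s] by (simp add: field_simps flip: power_mult power_add)
  qed
  have sS: "- ln (- t) \<ge> S" if "- exp (- S) < t" "t < 0" for t
    using that ln_less_cancel_iff[of "- t" "exp (- S)"] by simp
  have scale: "f j (X t) (Z t) = f j (x (- ln (- t))) (y (- ln (- t))) / (E (- ln (- t)) ^ 4) ^ j"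
    "h j (X t) (Z t) = h j (x (- ln (- t))) (y (- ln (- t))) / (E (- ln (- t)) ^ 4) ^ j"
    if "- exp (- S) < t" "t < 0" for t j
    unfolding XZ f_def h_def by (rule hom_field_scale[OF zero_less_power[OF E] xpos[OF sS[OF that]]])+
  have lim0: "((\<lambda>s. E s) \<longlongrightarrow> 0) at_top"
  proof -
    have "filterlim (\<lambda>s::real. - (1/10) * s) at_bot at_top"
      by (intro filterlim_tendsto_neg_mult_at_bot[OF tendsto_const _ filterlim_ident]) auto
    then show ?thesis
      unfolding E_def[abs_def] by (rule filterlim_compose[OF exp_at_bot])
  qed
  have limE: "((\<lambda>s. E s * r s) \<longlongrightarrow> 0) at_top" if "\<And>s. \<bar>r s\<bar> \<le> K" for r
  proof (rule Lim_null_comparison)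
    show "\<forall>\<^sub>F s in at_top. norm (E s * r s) \<le> E s * K"
      using that E[THEN less_imp_le] by (auto simp: abs_mult intro!: mult_mono always_eventually)
    show "((\<lambda>s. E s * K) \<longlongrightarrow> 0) at_top"
      using tendsto_mult_right[OF lim0, of K] by simp
  qed
  have xlim: "(x \<longlongrightarrow> x0) at_top" "(y \<longlongrightarrow> y0) at_top"
    using tendsto_add[OF tendsto_const limE[of p], of x0] tendsto_add[OF tendsto_const limE[of q], of y0] pqK
    by (simp_all add: x_def[abs_def] y_def[abs_def])
  show thesis
  proof (rule that[of "exp (- S)" X V Z W])
    show "exp (- S) > 0" by simp
    fix t assume t: "- exp (- S) < t" "t < 0"
    note s = sS[OF t]
    show "X t > 0"
      unfolding XZ by (rule mult_pos_pos[OF zero_less_power[OF E] xpos[OF s]])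
    show "(X has_real_derivative V t) (at t)"
      using rescaled_equation(1)[OF dp(1) dp' t] unfolding X_def V_def by blast
    show "(Z has_real_derivative W t) (at t)"
      using rescaled_equation(1)[OF dp(2) dq' t] unfolding Z_def W_def by blast
    have "(V has_real_derivative exp (8/5 * (- ln (- t))) *
        (Qx (- ln (- t)) - 6/25 * x (- ln (- t)))) (at t)"
      using rescaled_equation(2)[OF dp(1) dp' t] unfolding V_def x_def E_def by blast
    then show "(V has_real_derivative f 4 (X t) (Z t) + f 3 (X t) (Z t) + f 2 (X t) (Z t)) (at t)"
      unfolding scale[OF t] force[symmetric] Qx_def gx_def by (rule DERIV_cong) simp
    have "(W has_real_derivative exp (8/5 * (- ln (- t))) *
        (Qy (- ln (- t)) - 6/25 * y (- ln (- t)))) (at t)"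
      using rescaled_equation(2)[OF dp(2) dq' t] unfolding W_def y_def E_def by blast
    then show "(W has_real_derivative h 4 (X t) (Z t) + h 3 (X t) (Z t) + h 2 (X t) (Z t)) (at t)"
      unfolding scale[OF t] force[symmetric] Qy_def gy_def by (rule DERIV_cong) simp
  next
    have "((\<lambda>s. E s ^ 4 * x s) \<longlongrightarrow> 0 ^ 4 * x0) at_top" "((\<lambda>s. E s ^ 4 * y s) \<longlongrightarrow> 0 ^ 4 * y0) at_top"
      by (intro tendsto_intros lim0 xlim)+
    from this[THEN filterlim_compose, OF log_time_at_top]
    show "(X \<longlongrightarrow> 0) (at_left 0)" "(Z \<longlongrightarrow> 0) (at_left 0)"
      by (simp_all add: XZ[abs_def])
    have "((\<lambda>s. y s / x s) \<longlongrightarrow> y0 / x0) at_top"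
      using x0 by (intro tendsto_intros xlim) auto
    from filterlim_compose[OF this log_time_at_top]
    show "((\<lambda>t. Z t / X t) \<longlongrightarrow> y0 / x0) (at_left 0)"
      using E[THEN less_imp_neq] by (simp add: XZ[abs_def])
  qed
qed

section \<open>Triple collisions in the isosceles Schwarzschild problem\<close>

text \<open>
  The linearisation at the homothetic solution of the leading problem. With \<open>\<beta> = 96 B1 / (M \<rho>\<^sup>5 \<sigma>\<^sup>5)\<close>
  and \<open>n = \<mu> - 1\<close>, the condition \<open>cB\<close> and the choice of \<open>\<rho>\<close> turn all entries of the Jacobian into multiples of \<open>\<beta>\<close>. Its
  eigenvectors are the ray \<open>(1, l)\<close> and the direction orthogonal to it for the kinetic energy, in which
  the eigenvalue is \<open>20 \<beta> l\<^sup>2 (\<mu> - 1) / \<sigma>\<^sup>2\<close>.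
\<close>

lemma collision_solution_exists:
  fixes M m A A1 B B1 C l :: real
  defines "\<sigma> \<equiv> sqrt (1 + 4 * l\<^sup>2)"
  assumes pos: "M > 0" "m > 0" "B > 0" "B1 > 0"
    and cB: "B * \<sigma>^5 = 16 * B1 * (2 * M / m)"
  obtains T R z PR Pz where "T > 0" "solution M m A A1 B B1 C (ereal (- T)) 0 R z PR Pz"
    "(R \<longlongrightarrow> 0) (at_left 0)" "(z \<longlongrightarrow> 0) (at_left 0)" "((\<lambda>t. z t / R t) \<longlongrightarrow> l) (at_left 0)"
proof -
  have s: "\<sigma> > 0" "\<sigma>\<^sup>2 = 1 + 4 * l\<^sup>2" by (simp_all add: \<sigma>_def add_pos_nonneg)
  define n \<mu> where "n = 2 * M / m" and "\<mu> = n + 1"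
  have n: "n > 0" "\<mu> > 0" using pos by (simp_all add: n_def \<mu>_def add_pos_pos)
  \<comment> \<open>chosen so that \<open>\<rho> \<tau>\<^bsup>2/5\<^esup>\<close> has the acceleration prescribed by the forces of degree \<open>-4\<close>\<close>
  define \<rho> where "\<rho> = root 5 (400 * \<mu> * B1 / (M * \<sigma>^5))"
  have "400 * \<mu> * B1 / (M * \<sigma>^5) > 0" using pos n s by simp
  then have \<rho>: "\<rho> > 0" "\<rho>^5 = 400 * \<mu> * B1 / (M * \<sigma>^5)"
    by (simp_all add: \<rho>_def)
  define \<beta> where "\<beta> = 96 * B1 / (M * \<rho>^5 * \<sigma>^5)"
  have \<beta>: "\<beta> > 0" using pos \<rho>(1) s by (simp add: \<beta>_def)
  have \<mu>\<beta>: "6/25 = \<mu> * \<beta>"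
    unfolding \<beta>_def \<rho>(2) using pos n s by (simp add: field_simps)
  have B\<beta>: "6 * B / (M * \<rho>^5) = n * \<beta>"
  proof -
    have "B = 16 * B1 * n / \<sigma>^5" using cB s pos by (simp add: n_def field_simps)
    then show ?thesis by (simp add: \<beta>_def mult_ac)
  qed
  define \<tau> where "\<tau> = 1 / \<sigma>\<^sup>2"
  have \<tau>: "\<tau> > 0" "\<tau> * (1 + 4 * l\<^sup>2) = 1" using s by (simp_all add: \<tau>_def flip: s(2))
  define b where "b j = (if j = 4 then - 6 * B / M else if j = 3 then 4 * C\<^sup>2 / M\<^sup>2 else - 2 * A / M)" for j :: nat
  define c where "c j = (if j = 4 then - 96 * B1 / M else if j = 3 then 0 else - 8 * A1 / M)" for j :: nat
  define d where "d j = (if j = 4 then - 96 * \<mu> * B1 / M else if j = 3 then 0 else - 8 * \<mu> * A1 / M)" for j :: nat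
  define zr where "zr = (\<lambda>j :: nat. 0 :: real)"
  have rad: "rad \<rho> (l * \<rho>) = \<sigma> * \<rho>"
    using rad_scale[of \<rho> 1 l] \<rho>(1) by (simp add: mult.commute rad_def \<sigma>_def)
  have pw: "(\<sigma> * \<rho>)^7 = \<sigma>^5 * \<rho>^5 * (\<sigma>\<^sup>2 * \<rho>\<^sup>2)" "\<rho>^4 * \<rho> = \<rho>^5"
    using power_add[of "\<sigma> * \<rho>" 5 2] power_add[of \<rho> 4 1] by (simp_all add: power_mult_distrib)
  have f4: "hom_field (b 4) (c 4) (zr 4) 4 \<rho> (l * \<rho>) = - \<rho> * (\<mu> * \<beta>)"
  proof -
    have "hom_field (b 4) (c 4) (zr 4) 4 \<rho> (l * \<rho>) = - \<rho> * (6 * B / (M * \<rho>^5) + \<beta>)"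
      unfolding hom_field_def rad using \<rho>(1) s(1) pos
      by (simp add: b_def c_def zr_def \<beta>_def power_mult_distrib divide_simps flip: pw(2))
    then show ?thesis unfolding B\<beta> by (simp add: \<mu>_def algebra_simps)
  qed
  have h4: "hom_field (zr 4) (zr 4) (d 4) 4 \<rho> (l * \<rho>) = - (l * \<rho>) * (\<mu> * \<beta>)"
    unfolding hom_field_def rad
    by (simp add: d_def zr_def \<beta>_def power_mult_distrib mult_ac)
  have fx: "hom_field_dx (b 4) (c 4) (zr 4) 4 \<rho> (l * \<rho>) = 4 * n * \<beta> - \<beta> + 5 * \<beta> * \<tau>"
  proof -
    have "hom_field_dx (b 4) (c 4) (zr 4) 4 \<rho> (l * \<rho>) = 4 * (6 * B / (M * \<rho>^5)) - \<beta> + 5 * \<beta> * \<tau>"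
      unfolding hom_field_dx_def rad using \<rho>(1)
      by (simp add: b_def c_def zr_def \<beta>_def \<tau>_def pw(1)) (simp add: power_mult_distrib power2_eq_square mult_ac)
    then show ?thesis unfolding B\<beta> by simp
  qed
  have fy: "hom_field_dy (b 4) (c 4) (zr 4) 4 \<rho> (l * \<rho>) = 20 * \<beta> * l * \<tau>"
    unfolding hom_field_dy_def rad using \<rho>(1)
    by (simp add: c_def zr_def \<beta>_def \<tau>_def pw(1)) (simp add: power2_eq_square mult_ac)
  have hx: "hom_field_dx (zr 4) (zr 4) (d 4) 4 \<rho> (l * \<rho>) = 5 * \<mu> * \<beta> * l * \<tau>"
    unfolding hom_field_dx_def rad using \<rho>(1)
    by (simp add: d_def zr_def \<beta>_def \<tau>_def pw(1)) (simp add: power2_eq_square mult_ac)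
  have hy: "hom_field_dy (zr 4) (zr 4) (d 4) 4 \<rho> (l * \<rho>) = - \<mu> * \<beta> + 20 * \<mu> * \<beta> * l\<^sup>2 * \<tau>"
    unfolding hom_field_dy_def rad using \<rho>(1)
    by (simp add: d_def zr_def \<beta>_def \<tau>_def pw(1)) (simp add: power_mult_distrib power2_eq_square mult_ac)
  \<comment> \<open>orthogonality of \<open>(- \<gamma>, 1)\<close> and \<open>(1, l)\<close> for the kinetic energy, whose masses have ratio \<open>4 / \<mu>\<close>\<close>
  define \<gamma> where "\<gamma> = 4 * l / \<mu>"
  have \<gamma>: "\<gamma> * \<mu> = 4 * l" using n by (simp add: \<gamma>_def)
  have \<tau>1: "4 * l * l * \<tau> = 1 - \<tau>" using \<tau>(2) by (simp add: power2_eq_square algebra_simps)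
  obtain T X Z V W where T: "T > 0"
    and X: "\<And>t. - T < t \<Longrightarrow> t < 0 \<Longrightarrow> X t > 0"
    and dX: "\<And>t. - T < t \<Longrightarrow> t < 0 \<Longrightarrow> (X has_real_derivative V t) (at t)"
    and dZ: "\<And>t. - T < t \<Longrightarrow> t < 0 \<Longrightarrow> (Z has_real_derivative W t) (at t)"
    and dV: "\<And>t. - T < t \<Longrightarrow> t < 0 \<Longrightarrow> (V has_real_derivative
      hom_field (b 4) (c 4) (zr 4) 4 (X t) (Z t) + hom_field (b 3) (c 3) (zr 3) 3 (X t) (Z t)
       + hom_field (b 2) (c 2) (zr 2) 2 (X t) (Z t)) (at t)"
    and dW: "\<And>t. - T < t \<Longrightarrow> t < 0 \<Longrightarrow> (W has_real_derivative
      hom_field (zr 4) (zr 4) (d 4) 4 (X t) (Z t) + hom_field (zr 3) (zr 3) (d 3) 3 (X t) (Z t)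
       + hom_field (zr 2) (zr 2) (d 2) 2 (X t) (Z t)) (at t)"
    and lim: "(X \<longlongrightarrow> 0) (at_left 0)" "(Z \<longlongrightarrow> 0) (at_left 0)"
      "((\<lambda>t. Z t / X t) \<longlongrightarrow> l * \<rho> / \<rho>) (at_left 0)"
  proof (rule collision_along_hyperbolic_ray[of \<rho> b c zr "l * \<rho>" zr zr d l "5 * \<mu> * \<beta>" \<gamma> "20 * \<beta> * l\<^sup>2 * n * \<tau>"])
    show "\<rho> > 0" by (rule \<rho>)
    show "6/25 * \<rho> + hom_field (b 4) (c 4) (zr 4) 4 \<rho> (l * \<rho>) = 0"
      "6/25 * (l * \<rho>) + hom_field (zr 4) (zr 4) (d 4) 4 \<rho> (l * \<rho>) = 0"
      unfolding f4 h4 \<mu>\<beta> by simp_all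
    have "5 * \<beta> * n + 5 * \<beta> * (\<tau> * (1 + 4 * l\<^sup>2)) = 5 * \<mu> * \<beta>"
      unfolding \<tau> by (simp add: \<mu>_def algebra_simps)
    then show "6/25 + hom_field_dx (b 4) (c 4) (zr 4) 4 \<rho> (l * \<rho>)
        + hom_field_dy (b 4) (c 4) (zr 4) 4 \<rho> (l * \<rho>) * l = 5 * \<mu> * \<beta>"
      unfolding fx fy \<mu>\<beta> by (simp add: \<mu>_def algebra_simps power2_eq_square)
    have "5 * \<mu> * \<beta> * l * (\<tau> * (1 + 4 * l\<^sup>2)) = 5 * \<mu> * \<beta> * l"
      unfolding \<tau> by simp
    then show "hom_field_dx (zr 4) (zr 4) (d 4) 4 \<rho> (l * \<rho>)
        + (6/25 + hom_field_dy (zr 4) (zr 4) (d 4) 4 \<rho> (l * \<rho>)) * l = 5 * \<mu> * \<beta> * l"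
      unfolding hx hy \<mu>\<beta> by (simp add: algebra_simps power2_eq_square)
    have "- \<gamma> * (5 * n * \<beta> + 5 * \<beta> * \<tau>) + 20 * \<beta> * l * \<tau> = - \<gamma> * (5 * n * \<beta> + 5 * \<beta> * \<tau>) + 5 * \<beta> * (\<gamma> * \<mu>) * \<tau>"
      unfolding \<gamma> by simp
    also have "\<dots> = - \<gamma> * (5 * \<beta> * n * (1 - \<tau>))"
      by (simp add: \<mu>_def algebra_simps)
    also have "\<dots> = - \<gamma> * (20 * \<beta> * l\<^sup>2 * n * \<tau>)"
      unfolding \<tau>1[symmetric] by (simp add: power2_eq_square algebra_simps)
    finally show "- \<gamma> * (6/25 + hom_field_dx (b 4) (c 4) (zr 4) 4 \<rho> (l * \<rho>))
        + hom_field_dy (b 4) (c 4) (zr 4) 4 \<rho> (l * \<rho>) = - \<gamma> * (20 * \<beta> * l\<^sup>2 * n * \<tau>)"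
      unfolding fx fy \<mu>\<beta> by (simp add: \<mu>_def algebra_simps)
    have "- \<gamma> * (5 * \<mu> * \<beta> * l * \<tau>) + 20 * \<mu> * \<beta> * l\<^sup>2 * \<tau> = - (\<gamma> * \<mu>) * (5 * \<beta> * l * \<tau>) + 20 * \<mu> * \<beta> * l\<^sup>2 * \<tau>"
      by simp
    also have "\<dots> = 20 * \<beta> * l\<^sup>2 * n * \<tau>"
      unfolding \<gamma> by (simp add: \<mu>_def power2_eq_square algebra_simps)
    finally show "- \<gamma> * hom_field_dx (zr 4) (zr 4) (d 4) 4 \<rho> (l * \<rho>)
        + (6/25 + hom_field_dy (zr 4) (zr 4) (d 4) 4 \<rho> (l * \<rho>)) = 20 * \<beta> * l\<^sup>2 * n * \<tau>"
      unfolding hx hy \<mu>\<beta> by simp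
    show "5 * \<mu> * \<beta> \<ge> 0" "20 * \<beta> * l\<^sup>2 * n * \<tau> \<ge> 0" "\<gamma> * l \<ge> 0"
      using n \<beta> \<tau> by (simp_all add: \<gamma>_def)
  qed blast
  define \<kappa> where "\<kappa> = (2*M + m) / (2*M*m)"
  have \<kappa>: "\<kappa> > 0" "\<mu> = 2 * M * \<kappa>"
    using pos by (simp_all add: \<kappa>_def \<mu>_def n_def field_simps add_pos_pos)
  have FR: "M / 2 * (hom_field (b 4) (c 4) (zr 4) 4 x y + hom_field (b 3) (c 3) (zr 3) 3 x y
       + hom_field (b 2) (c 2) (zr 2) 2 x y) = force_R M A A1 B B1 C x y" for x y
    using pos by (simp add: hom_field_def force_R_def b_def c_def zr_def power2_eq_square
      distrib_left right_diff_distrib add_divide_distrib diff_divide_distrib)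
  have FZ: "1 / \<kappa> * (hom_field (zr 4) (zr 4) (d 4) 4 x y + hom_field (zr 3) (zr 3) (d 3) 3 x y
       + hom_field (zr 2) (zr 2) (d 2) 2 x y) = force_z A1 B1 x y" for x y
    using pos \<kappa>(1) by (simp add: hom_field_def force_z_def d_def zr_def \<kappa>(2)
      distrib_left right_diff_distrib add_divide_distrib diff_divide_distrib)
  show thesis
  proof (rule that[OF T])
    show "solution M m A A1 B B1 C (ereal (- T)) 0 X Z (\<lambda>t. M / 2 * V t) (\<lambda>t. 1 / \<kappa> * W t)"
      unfolding solution_iff[OF pos(1,2)]
    proof (intro conjI ballI)
      show "ereal (- T) < 0" using T by simp
      fix t assume "t \<in> einterval (ereal (- T)) 0"
      then have t: "- T < t" "t < 0" by (simp_all add: einterval_iff)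
      show "X t > 0" by (rule X[OF t])
      show "(X has_real_derivative 2 / M * (M / 2 * V t)) (at t)"
        using dX[OF t] pos by simp
      show "(Z has_real_derivative (2*M + m) / (2*M*m) * (1 / \<kappa> * W t)) (at t)"
        unfolding \<kappa>_def[symmetric] using dZ[OF t] \<kappa>(1) by simp
      show "((\<lambda>t. M / 2 * V t) has_real_derivative force_R M A A1 B B1 C (X t) (Z t)) (at t)"
        unfolding FR[symmetric] by (rule DERIV_cmult[OF dV[OF t]])
      show "((\<lambda>t. 1 / \<kappa> * W t) has_real_derivative force_z A1 B1 (X t) (Z t)) (at t)"
        unfolding FZ[symmetric] by (rule DERIV_cmult[OF dW[OF t]])
    qed
  qed (use lim \<rho>(1) in simp_all)
qed

text \<open>
  If the same \<open>\<sigma>\<close> balanced the forces of both degrees, eliminating it would give the equation of powers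
  that the theorem excludes.
\<close>

lemma central_configurations_distinct:
  fixes n a b \<sigma> :: real
  assumes "n > 0" "a > 0" "b > 0" "\<sigma> > 0"
    and "\<sigma>^3 = n * a" "\<sigma>^5 = n * b"
  shows "n powr (4/15) * a powr (2/3) = b powr (2/5)"
proof -
  have "\<sigma> powr 2 = (\<sigma> powr 3) powr (2/3)" "\<sigma> powr 2 = (\<sigma> powr 5) powr (2/5)"
    by (simp_all add: powr_powr)
  moreover have "\<sigma> powr 3 = n * a" "\<sigma> powr 5 = n * b"
    using assms powr_realpow[of \<sigma> 3] powr_realpow[of \<sigma> 5] by simp_all
  ultimately have "n powr (2/3) * a powr (2/3) = n powr (2/5) * b powr (2/5)"
    using assms by (simp add: powr_mult)
  moreover have "n powr (2/3) = n powr (2/5) * n powr (4/15)"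
    by (simp flip: powr_add)
  ultimately show ?thesis using assms(1) by simp
qed

theorem mainTheorem9:
  fixes M m A A1 B B1 \<mu> :: real
  assumes "M > 0" and "m > 0" and "A > 0" and "A1 > 0" and "B > 0" and "B1 > 0"
    and "\<mu> = (2*M + m) / m"
    and "\<mu> > 1 + A / (4*A1)"
    and "\<mu> > 1 + B / (16*B1)"
    and "(\<mu> - 1) powr (4/15) * (4*A1 / A) powr (2/3) \<noteq> (16*B1 / B) powr (2/5)"
  shows "\<forall>C::real.
     (\<exists>a b R z PR Pz l.
        triple_collision_solution M m A A1 B B1 C a b R z PR Pz \<and>
        limiting_configuration b R z l \<and>
        nondegenerate_triangle l \<and>
        \<not> homographic_configuration M m A A1 B B1 l) \<and>
     (\<exists>a b R z PR Pz.
        triple_collision_solution M m A A1 B B1 C a b R z PR Pz \<and>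
        \<not> homothetic_solution M m A A1 B B1 C a b R z PR Pz \<and>
        \<not> homographic_solution M m A A1 B B1 C a b R z PR Pz)"
proof
  fix C :: real
  note pos = assms(1,2,4,6)
  define n where "n = 2 * M / m"
  have n: "n = \<mu> - 1" "n > 0" using assms(1,2,7) by (simp_all add: n_def field_simps)
  define \<sigma> where "\<sigma> = root 5 (n * (16 * B1 / B))"
  have "n * (16 * B1 / B) > 1"
    unfolding n(1) using assms(5,6,9) by (simp add: field_simps)
  then have \<sigma>: "\<sigma> > 1" "\<sigma>^5 = n * (16 * B1 / B)"
    by (simp_all add: \<sigma>_def)
  define l where "l = sqrt ((\<sigma>\<^sup>2 - 1) / 4)"
  have "\<sigma>\<^sup>2 > 1" using \<sigma>(1) by simp
  then have l: "l > 0" and "1 + 4 * l\<^sup>2 = \<sigma>\<^sup>2" by (simp_all add: l_def field_simps)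
  then have \<sigma>l: "sqrt (1 + 4 * l\<^sup>2) = \<sigma>" using \<sigma>(1) by simp
  have cB: "B * sqrt (1 + 4 * l\<^sup>2)^5 = 16 * B1 * (2 * M / m)"
    unfolding \<sigma>l \<sigma>(2) n_def[symmetric] using assms(5) by simp
  have cA: "A * sqrt (1 + 4 * l\<^sup>2)^3 \<noteq> 4 * A1 * (2 * M / m)"
  proof
    assume "A * sqrt (1 + 4 * l\<^sup>2)^3 = 4 * A1 * (2 * M / m)"
    then have "\<sigma>^3 = n * (4 * A1 / A)"
      unfolding \<sigma>l n_def[symmetric] using assms(3) by (simp add: field_simps)
    from central_configurations_distinct[OF n(2) _ _ _ this \<sigma>(2)]
    show False using assms \<sigma>(1) n(1) by simp
  qed
  obtain T R0 z0 PR0 Pz0 where "T > 0" "solution M m A A1 B B1 C (ereal (- T)) 0 R0 z0 PR0 Pz0"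
    "(R0 \<longlongrightarrow> 0) (at_left 0)" "(z0 \<longlongrightarrow> 0) (at_left 0)" "((\<lambda>t. z0 t / R0 t) \<longlongrightarrow> l) (at_left 0)"
    using collision_solution_exists[OF assms(1,2,5,6) cB] by blast
  then obtain a R z PR Pz where tc: "triple_collision_solution M m A A1 B B1 C a 0 R z PR Pz"
    and lim: "((\<lambda>t. z t / R t) \<longlongrightarrow> l) (at_left 0)"
    using triple_collision_extension[OF assms(1,2)] by blast
  have "limiting_configuration 0 R z (ereal l)"
    using lim forward_end_ereal[of 0] by (simp add: limiting_configuration_def zero_ereal_def)
  moreover have "nondegenerate_triangle (ereal l)"
    using l by (simp add: nondegenerate_triangle_def)
  moreover have "\<not> homographic_configuration M m A A1 B B1 (ereal l)"
  proof
    assume "homographic_configuration M m A A1 B B1 (ereal l)"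
    then obtain C' a' b' R' z' PR' Pz' where
      sol: "solution M m A A1 B B1 C' a' b' R' z' PR' Pz'"
      and eq: "\<And>t. t \<in> einterval a' b' \<Longrightarrow> z' t / R' t = l"
      unfolding homographic_configuration_def homographic_solution_def by auto
    have "z' t = l * R' t" if "t \<in> einterval a' b'" for t
      using eq[OF that] sol that by (auto simp: solution_def field_simps)
    with no_solution_on_ray[OF pos _ cB cA sol] l show False by simp
  qed
  moreover have not_hom: "\<not> homographic_solution M m A A1 B B1 C a 0 R z PR Pz"
    using homographic_limit_ray[OF _ pos _ cB cA lim] l by auto
  moreover have "\<not> homothetic_solution M m A A1 B B1 C a 0 R z PR Pz"
    using not_hom by (auto simp: homothetic_solution_def homographic_solution_def)
  ultimately show "(\<exists>a b R z PR Pz l.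
        triple_collision_solution M m A A1 B B1 C a b R z PR Pz \<and>
        limiting_configuration b R z l \<and>
        nondegenerate_triangle l \<and>
        \<not> homographic_configuration M m A A1 B B1 l) \<and>
     (\<exists>a b R z PR Pz.
        triple_collision_solution M m A A1 B B1 C a b R z PR Pz \<and>
        \<not> homothetic_solution M m A A1 B B1 C a b R z PR Pz \<and>
        \<not> homographic_solution M m A A1 B B1 C a b R z PR Pz)"
    using tc by blast
qed

end
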